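(* Let $n\ge3$ be an integer and let $D_1,D_2,D,\alpha$ be the constants depending on $n$ defined in the context. Then there are polynomials $P\in S(n+1,\beta)$ with real coefficients (one for each $\beta<1$ sufficiently close to $1$) such that $$|P|_\beta=1+(D_1+D_2/n)(1-\beta)+D(1-\beta)^2+\mathcal O\big((1-\beta)^{\alpha+1}\big).$$
   Context: $\beta$ denotes a real number with $0\le\beta\le 1$. $S(n+1,\beta)$ is the set of complex polynomials of degree $n+1$ with all roots in the closed unit disk and at least one root at $\beta$. For a polynomial $P$, $|P|_\beta$ is the distance between $\beta$ and the closest root of the derivative $P'$. Constants: for $n\ge3$ let $k$ be the largest integer with $k\le(n+1)/3$, and let $u_1=\cos\frac{2\pi k}{n+1}$, $u_2=\cos\frac{2\pi(k+1)}{n+1}$, $D_1=\frac{-2u_1u_2-1}{2(1-u_1)(1-u_2)}$, $D_2=\frac{-1}{2(1-u_1)(1-u_2)}$, $D_3=(-1-4D_1-3D_1^2+2D_2^2)/2$, $D_4=(3D_1-4D_2+3D_1^2-2D_1D_2-6D_2^2)/2$, $D_5=(2+4D_1+5D_2+2D_1^2+4D_1D_2+3D_2^2)/2$, $D_6=(2D_2+2D_1D_2+3D_2^2)/2$, $D=D_3n+D_4+D_5/n+D_6/n^2$. If $n=3$ or $n=5$ then $\alpha=3/2$; otherwise $\alpha=2$. The notation $\mathcal O((1-\beta)^s)$ denotes a quantity bounded in modulus by $C(1-\beta)^s$ for all $\beta\in(\beta_0,1)$, where $C$ and $\beta_0<1$ depend only on $n$. *)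

theory Defs
  imports "HOL-Analysis.Analysis" "HOL-Computational_Algebra.Computational_Algebra"
begin

text \<open>\<open>sendov_class d \<beta>\<close> is the class written \<open>S(d, \<beta>)\<close> in the literature.\<close>

definition sendov_class :: "nat \<Rightarrow> real \<Rightarrow> complex poly set" where
  "sendov_class d \<beta> =
     {P. degree P = d \<and> (\<forall>z. poly P z = 0 \<longrightarrow> norm z \<le> 1) \<and> poly P (of_real \<beta>) = 0}"

text \<open>
  This is \<open>|P|\<^sub>\<beta>\<close>.  If \<open>degree P \<ge> 2\<close> the set of critical points is finite and nonempty, so
  the infimum in \<^const>\<open>infdist\<close> is attained at a closest one.
\<close>

definition crit_dist :: "real \<Rightarrow> complex poly \<Rightarrow> real" where
  "crit_dist \<beta> P = infdist (of_real \<beta>) {z. poly (pderiv P) z = 0}"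

definition kk :: "nat \<Rightarrow> int" where
  "kk n = \<lfloor>(real n + 1) / 3\<rfloor>"

definition u1 :: "nat \<Rightarrow> real" where
  "u1 n = cos (2 * pi * of_int (kk n) / (real n + 1))"

definition u2 :: "nat \<Rightarrow> real" where
  "u2 n = cos (2 * pi * (of_int (kk n) + 1) / (real n + 1))"

definition D1 :: "nat \<Rightarrow> real" where
  "D1 n = (- 2 * u1 n * u2 n - 1) / (2 * (1 - u1 n) * (1 - u2 n))"

definition D2 :: "nat \<Rightarrow> real" where
  "D2 n = - 1 / (2 * (1 - u1 n) * (1 - u2 n))"

definition D3 :: "nat \<Rightarrow> real" where
  "D3 n = (- 1 - 4 * D1 n - 3 * (D1 n)\<^sup>2 + 2 * (D2 n)\<^sup>2) / 2"

definition D4 :: "nat \<Rightarrow> real" where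
  "D4 n = (3 * D1 n - 4 * D2 n + 3 * (D1 n)\<^sup>2 - 2 * D1 n * D2 n - 6 * (D2 n)\<^sup>2) / 2"

definition D5 :: "nat \<Rightarrow> real" where
  "D5 n = (2 + 4 * D1 n + 5 * D2 n + 2 * (D1 n)\<^sup>2 + 4 * D1 n * D2 n + 3 * (D2 n)\<^sup>2) / 2"

definition D6 :: "nat \<Rightarrow> real" where
  "D6 n = (2 * D2 n + 2 * D1 n * D2 n + 3 * (D2 n)\<^sup>2) / 2"

definition DD :: "nat \<Rightarrow> real" where
  "DD n = D3 n * real n + D4 n + D5 n / real n + D6 n / (real n)\<^sup>2"

definition alpha :: "nat \<Rightarrow> real" where
  "alpha n = (if n = 3 \<or> n = 5 then 3 / 2 else 2)"

end

theory Submission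
  imports Defs "HOL-Library.Landau_Symbols"
begin

text \<open>
  At \<open>\<beta> = 1\<close> the polynomial \<open>z ^ (n + 1) - 1\<close> has all critical points at distance \<open>1\<close> from
  \<open>\<beta>\<close>.  For \<open>\<beta> = 1 - e\<close> the proof keeps all critical points on one circle of radius \<open>R\<close> around
  \<open>\<beta>\<close>: the point \<open>\<beta> - R\<close> with multiplicity \<open>n - 2\<close>, and a conjugate pair close to it.
  Then \<open>crit_dist \<beta> P = R\<close> exactly (lemma \<open>crit_dist_circle_poly\<close>), and the theorem becomes
  the question which \<open>R\<close> leave all roots of \<open>P\<close> in the unit disk.

  In the coordinate \<open>z = \<beta> + R (q - 1)\<close> the equation \<open>P z = 0\<close> reads
  \<open>q ^ (n + 1) = 1 + \<mu> * drift n q\<close>, where \<open>\<mu>\<close> measures the angle of the conjugate pair and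
  \<open>R\<close> has disappeared.  So every root is \<open>q = \<omega> * exp \<tau>\<close> with \<open>\<omega>\<close> an \<open>(n + 1)\<close>-st root of unity
  and \<open>(n + 1) * \<tau> = Ln (1 + \<mu> * drift n q)\<close>, and iterating this relation gives \<open>\<tau>\<close> up to
  \<open>O(\<mu>^3)\<close> (lemma \<open>root_log_expansion\<close>).  With \<open>u = Re \<omega>\<close>, \<open>\<mu> = m e + m' e^2\<close> and
  \<open>R = 1 + c e + D e^2\<close> one obtains \<open>|z|^2 - 1 = G(u) e + H(u) e^2 + O(e^3)\<close>
  (lemma \<open>excess_expansion\<close>).

  The function \<open>G\<close> is a quadratic polynomial in \<open>u\<close> with \<open>G(1) = -2\<close>.  Choosing
  \<open>c = D1 + D2 / n\<close> and \<open>m = - D2\<close> amounts to \<open>G(u) = - 4 m (u - u1) (u - u2)\<close>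
  (lemma \<open>first_order_gap\<close>), which is never positive at a root of unity other than \<open>1\<close>, because
  \<open>u1\<close> and \<open>u2\<close> are neighbours among the real parts of these roots.  At the tight values
  \<open>u = u1\<close> and \<open>u = u2\<close> the second order decides.  The two equations \<open>H(u1) = H(u2) = 0\<close> are
  linear in the two unknowns \<open>D\<close> and \<open>m'\<close>, and their solution has \<open>D = DD n\<close>
  (lemma \<open>second_order_balance\<close>).  What remains is an error \<open>O(e^3)\<close>; shrinking \<open>R\<close> by
  \<open>K e^3\<close> lowers \<open>|z|^2\<close> by about \<open>2 K (1 - u) e^3\<close>, which beats the error once \<open>K\<close> is large
  (lemma \<open>excess_eventually_nonpos\<close>).  The branch \<open>\<omega> = 1\<close> contains only \<open>q = 1\<close>, that is \<open>z = \<beta>\<close>,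
  for small \<open>e\<close> (lemma \<open>branch_at_1_trivial\<close>).
\<close>

section \<open>Polynomials with all critical points on a circle\<close>

definition drift :: "nat \<Rightarrow> complex \<Rightarrow> complex" where
  "drift n q = of_nat (n + 1) * (of_real (1 - 1 / real n) * (q ^ n - 1) - (q ^ (n - 1) - 1))"

text \<open>
  In the coordinate \<open>q = 1 + (z - \<beta>) / R\<close> this is the antiderivative, vanishing at \<open>q = 1\<close>, of
  \<open>(n + 1) * q ^ (n - 2) * (q^2 - \<mu> * (n - 1) * (q - 1))\<close>.  The quadratic factor is
  \<open>t^2 + (2 - \<mu> * (n - 1)) * t + 1\<close> with \<open>t = q - 1\<close>, so its roots lie on \<open>|t| = 1\<close> for small
  \<open>\<mu> \<ge> 0\<close>, just like the root \<open>t = - 1\<close> of \<open>q ^ (n - 2)\<close>.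
\<close>

definition circle_poly :: "nat \<Rightarrow> real \<Rightarrow> real \<Rightarrow> real \<Rightarrow> complex poly" where
  "circle_poly n \<beta> R \<mu> =
     (let L = [:of_real (1 - \<beta> / R), of_real (1 / R):]
      in L ^ (n + 1) - 1
         - smult (of_real (\<mu> * real (n + 1))) (smult (of_real (1 - 1 / real n)) (L ^ n - 1) - (L ^ (n - 1) - 1)))"

lemma poly_circle_poly:
  "poly (circle_poly n \<beta> R \<mu>) z =
     (1 + (z - of_real \<beta>) / of_real R) ^ (n + 1) - (1 + of_real \<mu> * drift n (1 + (z - of_real \<beta>) / of_real R))"
proof -
  have "poly [:of_real (1 - \<beta> / R), of_real (1 / R):] z = 1 + (z - of_real \<beta>) / of_real R"
    by (simp add: diff_divide_distrib)
  thus ?thesis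
    unfolding circle_poly_def drift_def Let_def
    by (simp only: poly_diff poly_smult poly_power poly_1 of_real_mult of_real_of_nat_eq
        poly_add mult.assoc diff_diff_eq)
qed

lemma degree_circle_poly:
  assumes "n \<ge> 1" "R \<noteq> 0"
  shows "degree (circle_poly n \<beta> R \<mu>) = n + 1"
proof -
  define L :: "complex poly" where "L = [:of_real (1 - \<beta> / R), of_real (1 / R):]"
  have dL: "degree L = 1" using assms by (simp add: L_def)
  have "L \<noteq> 0" using dL by auto
  then have dp: "degree (L ^ k) = k" for k by (simp add: degree_power_eq dL)
  define Q where "Q = - 1 - smult (of_real (\<mu> * real (n + 1))) (smult (of_real (1 - 1 / real n)) (L ^ n - 1) - (L ^ (n - 1) - 1))"
  have "degree Q \<le> n" unfolding Q_def
    by (intro degree_diff_le order.trans[OF degree_smult_le]) (auto simp: dp)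
  moreover have "circle_poly n \<beta> R \<mu> = L ^ (n + 1) + Q"
    by (simp add: circle_poly_def Q_def L_def Let_def)
  ultimately show ?thesis
    using dp[of "n + 1"] by (simp add: degree_add_eq_left)
qed

lemma real_coeffs_mult:
  fixes p q :: "complex poly"
  assumes "\<forall>i. coeff p i \<in> \<real>" "\<forall>i. coeff q i \<in> \<real>"
  shows "\<forall>i. coeff (p * q) i \<in> \<real>"
  using assms by (auto simp: coeff_mult intro!: sum_in_Reals Reals_mult)

lemma real_coeffs_power:
  fixes p :: "complex poly"
  assumes "\<forall>i. coeff p i \<in> \<real>"
  shows "\<forall>i. coeff (p ^ k) i \<in> \<real>"
proof (induction k)
  case 0
  show ?case by (simp add: one_pCons coeff_pCons split: nat.split)
next
  case (Suc k)
  show ?case unfolding power_Suc by (rule real_coeffs_mult[OF assms Suc])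
qed

lemma real_coeffs_circle_poly: "coeff (circle_poly n \<beta> R \<mu>) i \<in> \<real>"
proof -
  define L :: "complex poly" where "L = [:of_real (1 - \<beta> / R), of_real (1 / R):]"
  have "\<forall>i. coeff L i \<in> \<real>"
    unfolding L_def by (auto simp: coeff_pCons split: nat.split)
  then have "coeff (L ^ k) i \<in> \<real>" for k
    using real_coeffs_power by blast
  moreover have "coeff (1 :: complex poly) i \<in> \<real>" by (simp add: one_pCons coeff_pCons split: nat.split)
  ultimately show ?thesis
    unfolding circle_poly_def Let_def L_def[symmetric] coeff_diff coeff_smult
    by (intro Reals_diff Reals_mult Reals_of_real)
qed

lemma poly_pderiv_circle_poly:
  assumes "n \<ge> 2" "R \<noteq> 0"
  shows "poly (pderiv (circle_poly n \<beta> R \<mu>)) z =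
    (let q = 1 + (z - of_real \<beta>) / of_real R
     in of_real (real (n + 1) / R) * q ^ (n - 2) * (q\<^sup>2 - of_real (\<mu> * (real n - 1)) * (q - 1)))"
proof -
  obtain m where n: "n = Suc (Suc m)"
    using assms by (metis Suc_le_D numeral_2_eq_2 Suc_le_mono)
  define L :: "complex poly" where "L = [:of_real (1 - \<beta> / R), of_real (1 / R):]"
  define q where "q = 1 + (z - of_real \<beta>) / of_real R"
  have pL: "poly L z = q"
    by (simp add: L_def q_def diff_divide_distrib)
  have dL: "pderiv L = [:of_real (1 / R):]"
    by (simp add: L_def pderiv_pCons)
  have *: "poly (pderiv (L ^ Suc k)) z = of_nat (Suc k) * q ^ k / of_real R" for k
    unfolding pderiv_power_Suc dL by (simp add: pL)
  have "poly (pderiv (circle_poly n \<beta> R \<mu>)) z =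
     poly (pderiv (L ^ Suc (Suc (Suc m)))) z
       - of_real (\<mu> * real (n + 1)) * (of_real (1 - 1 / real n) * poly (pderiv (L ^ Suc (Suc m))) z - poly (pderiv (L ^ Suc m)) z)"
    unfolding circle_poly_def Let_def L_def[symmetric]
    by (simp add: n pderiv_diff pderiv_smult del: power_Suc)
  also have "\<dots> = of_real (real (n + 1) / R) * q ^ m * (q\<^sup>2 - of_real (\<mu> * (real n - 1)) * (q - 1))"
  proof -
    define N :: complex where "N = of_nat m"
    have "of_real (1 - 1 / real n) * (of_nat (Suc (Suc m)) :: complex) = of_real ((1 - 1 / real n) * real n)"
      by (simp only: n of_real_mult of_real_of_nat_eq)
    also have "(1 - 1 / real n) * real n = real m + 1" by (simp add: n field_simps)
    finally have "of_real (1 - 1 / real n) * (N + 2) = N + 1" by (simp add: N_def add_ac)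
    then have s: "of_real (1 - 1 / real n) * ((N + 2) * x) = (N + 1) * x" for x
      by (metis mult.assoc)
    have N: "of_nat (Suc m) = N + 1" "of_nat (Suc (Suc m)) = N + 2" "of_nat (Suc (Suc (Suc m))) = N + 3"
      "of_real (\<mu> * real (n + 1)) = of_real \<mu> * (N + 3)" "of_real (\<mu> * (real n - 1)) = of_real \<mu> * (N + 1)"
      "of_real (real (n + 1) / R) = (N + 3) / of_real R"
      by (simp_all add: N_def n)
    show ?thesis
      unfolding * N times_divide_eq_right[symmetric] mult.assoc s
      by (simp add: divide_inverse algebra_simps power2_eq_square)
  qed
  finally show ?thesis by (simp add: q_def n Let_def)
qed

text \<open>
  The bounds on \<open>k\<close> say that the discriminant is not positive, so the roots are conjugate (or
  double), and the product of the values \<open>q - 1\<close> at the two roots is \<open>1\<close>.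
\<close>

lemma quadratic_root_on_circle:
  fixes q :: complex and k :: real
  assumes k: "0 \<le> k" "k \<le> 4" and q: "q\<^sup>2 = of_real k * (q - 1)"
  shows "norm (q - 1) = 1"
proof -
  define x y where "x = Re q" and "y = Im q"
  have 1: "x\<^sup>2 - y\<^sup>2 = k * (x - 1)" and 2: "2 * x * y = k * y"
    using q by (auto simp: complex_eq_iff x_def y_def power2_eq_square)
  have "(x - 1)\<^sup>2 + y\<^sup>2 = 1"
  proof (cases "y = 0")
    case True
    then have "(2 * x - k)\<^sup>2 = k * (k - 4)" using 1 by (simp add: power2_eq_square algebra_simps)
    moreover have "k * (k - 4) \<le> 0" using k by (simp add: mult_nonneg_nonpos)
    ultimately have "(2 * x - k)\<^sup>2 = 0" "k * (k - 4) = 0"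
      by (smt (verit) zero_le_power2)+
    \<comment> \<open>A real root forces a vanishing discriminant, and then it is the double root \<open>k / 2\<close>.\<close>
    then have "2 * x = k" "k = 0 \<or> k = 4" by auto
    then have "x = 0 \<or> x = 2" by auto
    then show ?thesis using True by auto
  next
    case False
    then have "k = 2 * x" using 2 by simp
    then show ?thesis using 1 by (simp add: power2_eq_square algebra_simps)
  qed
  then show ?thesis by (simp add: norm_complex_def x_def y_def)
qed

lemma crit_dist_circle_poly:
  assumes n: "n \<ge> 3" and R: "R > 0" and \<mu>: "0 \<le> \<mu>" "\<mu> * (real n - 1) \<le> 4"
  shows "crit_dist \<beta> (circle_poly n \<beta> R \<mu>) = R"
proof -
  define S where "S = {z. poly (pderiv (circle_poly n \<beta> R \<mu>)) z = 0}"
  have "dist (of_real \<beta>) z = R" if "z \<in> S" for z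
  proof -
    define q where "q = 1 + (z - of_real \<beta>) / of_real R"
    have "q = 0 \<or> q\<^sup>2 = of_real (\<mu> * (real n - 1)) * (q - 1)"
      using that n R poly_pderiv_circle_poly[of n R \<beta> \<mu> z]
      by (auto simp: S_def Let_def q_def[symmetric] simp flip: of_nat_Suc)
    then have "norm (q - 1) = 1"
      using quadratic_root_on_circle[of "\<mu> * (real n - 1)" q] n \<mu> by auto
    then show ?thesis
      using R by (simp add: q_def norm_divide dist_norm norm_minus_commute)
  qed
  moreover have "of_real (\<beta> - R) \<in> S"
    using n R poly_pderiv_circle_poly[of n R \<beta> \<mu> "of_real (\<beta> - R)"]
    by (simp add: S_def Let_def)
  ultimately have "infdist (of_real \<beta>) S = R"
    unfolding infdist_def by (auto cong: INF_cong_simp)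
  then show ?thesis by (simp add: crit_dist_def S_def)
qed

lemma norm_drift_le:
  assumes "n \<ge> 1" "norm q \<le> r" "1 \<le> r"
  shows "norm (drift n q) \<le> 4 * real (n + 1) * r ^ n"
proof -
  have p: "norm q ^ (n - 1) \<le> r ^ n" "norm q ^ n \<le> r ^ n" "1 \<le> r ^ n"
    using assms by (auto intro: power_mono order.trans[OF power_mono power_increasing])
  have s: "0 \<le> 1 - 1 / real n" "1 - 1 / real n \<le> 1" using assms by auto
  have a: "norm (q ^ n - 1) \<le> 2 * r ^ n"
    using p norm_triangle_ineq4[of "q ^ n" 1] unfolding norm_power norm_one by linarith
  have b: "norm (q ^ (n - 1) - 1) \<le> 2 * r ^ n"
    using p norm_triangle_ineq4[of "q ^ (n - 1)" 1] unfolding norm_power norm_one by linarith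
  have c: "norm (of_real (1 - 1 / real n) * (q ^ n - 1)) \<le> 2 * r ^ n"
    using mult_mono[OF s(2) a] s by (simp add: norm_mult del: of_real_diff)
  have "norm (of_real (1 - 1 / real n) * (q ^ n - 1) - (q ^ (n - 1) - 1)) \<le> 4 * r ^ n"
    using norm_triangle_ineq4[of "of_real (1 - 1 / real n) * (q ^ n - 1)" "q ^ (n - 1) - 1"] b c by linarith
  then have "real (n + 1) * norm (of_real (1 - 1 / real n) * (q ^ n - 1) - (q ^ (n - 1) - 1))
      \<le> real (n + 1) * (4 * r ^ n)"
    by (intro mult_left_mono) auto
  then show ?thesis unfolding drift_def norm_mult norm_of_nat by (simp only: mult_ac)
qed

text \<open>For \<open>norm q > 2\<close> the term \<open>q ^ (n + 1)\<close> dominates \<open>\<mu> * drift n q\<close>, which only grows like \<open>q ^ n\<close>.\<close>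

lemma root_norm_le_2:
  assumes n: "n \<ge> 1" and \<mu>: "\<bar>\<mu>\<bar> * (4 * real (n + 1)) \<le> 1"
    and q: "q ^ (n + 1) = 1 + of_real \<mu> * drift n q"
  shows "norm q \<le> 2"
proof (rule ccontr)
  assume "\<not> norm q \<le> 2"
  then have q2: "norm q > 2" by simp
  have "norm q ^ (n + 1) = norm (1 + of_real \<mu> * drift n q)"
    by (simp only: q[symmetric] norm_power)
  also have "\<dots> \<le> 1 + \<bar>\<mu>\<bar> * norm (drift n q)"
    using norm_triangle_ineq[of 1 "of_real \<mu> * drift n q"]
    by (simp add: norm_mult)
  also have "\<bar>\<mu>\<bar> * norm (drift n q) \<le> \<bar>\<mu>\<bar> * (4 * real (n + 1) * norm q ^ n)"
    using norm_drift_le[OF n order.refl, of q] q2 by (intro mult_left_mono) auto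
  also have "\<dots> \<le> 1 * norm q ^ n"
    using mult_right_mono[OF \<mu>, of "norm q ^ n"] by (simp add: mult_ac)
  also have "1 + 1 * norm q ^ n \<le> 2 * norm q ^ n" using q2 by (simp add: one_le_power)
  finally have "norm q * norm q ^ n \<le> 2 * norm q ^ n" by simp
  moreover have "norm q ^ n > 0" using q2 by (intro zero_less_power) auto
  ultimately show False using q2 by (simp add: mult_le_cancel_right)
qed

section \<open>Roots near a root of unity\<close>

text \<open>
  The roots of the equation in \<open>q\<close> that are attached to the root of unity \<open>\<omega>\<close>.  The second
  conjunct is the first one with the \<open>(n + 1)\<close>-st root taken through the principal logarithm,
  and the bound on \<open>norm q\<close> keeps \<open>drift n q\<close> bounded.
\<close>

definition branch :: "nat \<Rightarrow> real \<Rightarrow> complex \<Rightarrow> complex \<Rightarrow> bool" where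
  "branch n \<mu> \<omega> q \<longleftrightarrow> q ^ (n + 1) = 1 + of_real \<mu> * drift n q \<and>
     q = \<omega> * exp (Ln (1 + of_real \<mu> * drift n q) / of_nat (n + 1)) \<and> norm q \<le> 2"

lemma root_on_branch:
  assumes n: "n \<ge> 1" and \<mu>: "\<bar>\<mu>\<bar> * (4 * real (n + 1) * 2 ^ n) < 1"
    and q: "q ^ (n + 1) = 1 + of_real \<mu> * drift n q"
  obtains \<omega> where "\<omega> ^ (n + 1) = 1" "branch n \<mu> \<omega> q"
proof -
  have "\<bar>\<mu>\<bar> * (4 * real (n + 1)) * 1 \<le> \<bar>\<mu>\<bar> * (4 * real (n + 1)) * 2 ^ n"
    by (intro mult_left_mono) auto
  then have q2: "norm q \<le> 2"
    using root_norm_le_2[OF n _ q] \<mu> by (simp add: mult_ac)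
  define T where "T = Ln (1 + of_real \<mu> * drift n q)"
  have "norm (of_real \<mu> * drift n q) \<le> \<bar>\<mu>\<bar> * (4 * real (n + 1) * 2 ^ n)"
    using norm_drift_le[OF n q2] by (simp add: norm_mult mult_left_mono)
  with \<mu> have "norm (of_real \<mu> * drift n q) < 1" by linarith
  then have "1 + of_real \<mu> * drift n q \<noteq> 0"
    by (metis add_eq_0_iff norm_minus_cancel norm_one order_less_irrefl)
  then have e: "exp T = q ^ (n + 1)" using q by (simp add: T_def)
  have "exp (T / of_nat (n + 1)) ^ (n + 1) = exp (of_nat (n + 1) * (T / of_nat (n + 1)))"
    by (simp only: exp_of_nat_mult)
  also have "of_nat (n + 1) * (T / of_nat (n + 1)) = T"
    by (metis Suc_eq_plus1 nonzero_mult_div_cancel_left of_nat_neq_0 times_divide_eq_right)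
  finally have e': "exp (T / of_nat (n + 1)) ^ (n + 1) = q ^ (n + 1)" using e by simp
  have "(q / exp (T / of_nat (n + 1))) ^ (n + 1) = 1"
    using e' e by (metis divide_self exp_not_eq_zero power_divide)
  moreover have "q = (q / exp (T / of_nat (n + 1))) * exp (T / of_nat (n + 1))" by simp
  ultimately show ?thesis using that q q2 unfolding T_def branch_def by blast
qed

section \<open>Asymptotic expansion of the roots\<close>

text \<open>
  With \<open>T = Ln (1 + \<delta>)\<close> the Taylor polynomial of \<open>exp\<close> gives \<open>\<delta> = T + T^2 / 2 + O(T^3)\<close>; replacing
  \<open>T^2\<close> by \<open>\<delta>^2\<close> costs \<open>(T - \<delta>) (T + \<delta>) = O(\<delta>^3)\<close> by the linear approximation of \<open>Ln\<close>.
\<close>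

lemma norm_Ln_second_order:
  fixes \<delta> :: complex
  assumes "norm \<delta> \<le> 1 / 2"
  shows "norm (Ln (1 + \<delta>) - (\<delta> - \<delta>\<^sup>2 / 2)) \<le> 15 * norm \<delta> ^ 3"
proof -
  define T where "T = Ln (1 + \<delta>)"
  have ne: "1 + \<delta> \<noteq> 0"
  proof
    assume "1 + \<delta> = 0"
    then have "\<delta> = - 1" by (simp add: add_eq_0_iff)
    then show False using assms by simp
  qed
  have "norm (T - \<delta>) \<le> norm \<delta> ^ 2 / (1 - norm \<delta>)"
    unfolding T_def using assms by (intro Ln_approx_linear) auto
  also have "\<dots> \<le> norm \<delta> ^ 2 / (1 / 2)"
    using assms by (intro divide_left_mono) auto
  finally have 1: "norm (T - \<delta>) \<le> 2 * norm \<delta> ^ 2" by simp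
  have "2 * norm \<delta> ^ 2 \<le> norm \<delta>"
    using assms mult_right_mono[OF assms, of "norm \<delta>"] by (simp add: power2_eq_square)
  then have 2: "norm T \<le> 2 * norm \<delta>"
    using 1 norm_triangle_sub[of T \<delta>] by linarith
  have 3: "norm (\<delta> + T) \<le> 3 * norm \<delta>"
    using 2 norm_triangle_ineq[of \<delta> T] by linarith
  have "norm (exp T - (\<Sum>i\<le>2. T ^ i / fact i)) \<le> exp (norm T) * norm T ^ Suc 2 / fact 2"
    by (rule Taylor_exp_field)
  also have "\<dots> \<le> 3 * (2 * norm \<delta>) ^ Suc 2 / fact 2"
  proof -
    have "exp (norm T) \<le> exp 1" using 2 assms by simp
    also have "exp 1 \<le> (3::real)" by (rule exp_le)
    finally show ?thesis
      using 2 by (intro divide_right_mono mult_mono power_mono) auto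
  qed
  also have "\<dots> = 12 * norm \<delta> ^ 3" by (simp add: power3_eq_cube power_mult_distrib)
  finally have 4: "norm (\<delta> - T - T\<^sup>2 / 2) \<le> 12 * norm \<delta> ^ 3"
    using ne by (simp add: T_def numeral_2_eq_2 algebra_simps)
  have "T - (\<delta> - \<delta>\<^sup>2 / 2) = - (\<delta> - T - T\<^sup>2 / 2) - (T - \<delta>) * (\<delta> + T) / 2"
    by (simp add: field_simps power2_eq_square)
  also have "norm \<dots> \<le> norm (\<delta> - T - T\<^sup>2 / 2) + norm (T - \<delta>) * norm (\<delta> + T) / 2"
    using norm_triangle_ineq4[of "- (\<delta> - T - T\<^sup>2 / 2)" "(T - \<delta>) * (\<delta> + T) / 2"]
    by (simp add: norm_mult norm_divide norm_minus_commute)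
  also have "norm (T - \<delta>) * norm (\<delta> + T) \<le> (2 * norm \<delta> ^ 2) * (3 * norm \<delta>)"
    by (intro mult_mono 1 3) auto
  also have "norm (\<delta> - T - T\<^sup>2 / 2) + (2 * norm \<delta> ^ 2) * (3 * norm \<delta>) / 2 \<le> 15 * norm \<delta> ^ 3"
    using 4 by (simp add: power2_eq_square power3_eq_cube mult.assoc)
  finally show ?thesis by (simp add: T_def divide_right_mono)
qed

lemma exp_Taylor_bigo:
  fixes t :: "'a \<Rightarrow> 'b :: {banach, real_normed_field}"
  assumes "(t \<longlongrightarrow> 0) F"
  shows "(\<lambda>x. exp (t x) - (\<Sum>i\<le>k. t x ^ i / fact i)) \<in> O[F](\<lambda>x. t x ^ Suc k)"
proof (rule bigoI[of _ "exp 1"])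
  have "\<forall>\<^sub>F x in F. norm (t x) < 1"
    using tendsto_norm[OF assms] by (intro order_tendstoD(2)[where y = 0]) auto
  then show "\<forall>\<^sub>F x in F. norm (exp (t x) - (\<Sum>i\<le>k. t x ^ i / fact i)) \<le> exp 1 * norm (t x ^ Suc k)"
  proof eventually_elim
    case (elim x)
    have "norm (exp (t x) - (\<Sum>i\<le>k. t x ^ i / fact i)) \<le> exp (norm (t x)) * norm (t x) ^ Suc k / fact k"
      by (rule Taylor_exp_field)
    also have "\<dots> \<le> exp 1 * norm (t x) ^ Suc k / 1"
      using elim fact_ge_1[of k, where 'a = real] by (intro frac_le mult_right_mono) auto
    finally show ?case by (simp add: norm_power norm_mult)
  qed
qed

lemma Re_bigo:
  assumes "f \<in> O[F](\<lambda>x. complex_of_real (h x))"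
  shows "(\<lambda>x. Re (f x)) \<in> O[F](h)"
proof -
  from assms obtain c where "\<forall>\<^sub>F x in F. norm (f x) \<le> c * norm (complex_of_real (h x))"
    by (auto simp: bigo_def)
  then have "\<forall>\<^sub>F x in F. norm (Re (f x)) \<le> c * norm (h x)"
    by eventually_elim (simp add: order.trans[OF abs_Re_le_cmod])
  then show ?thesis by (rule bigoI)
qed

lemma bigo_tendsto_0:
  assumes "f \<in> O[F](g)" "(g \<longlongrightarrow> 0) F"
  shows "(f \<longlongrightarrow> 0) F"
proof -
  have "g \<in> o[F](\<lambda>_. 1)" using assms by (intro smalloI_tendsto) auto
  with assms(1) have "f \<in> o[F](\<lambda>_. 1)" by (rule landau_o.big_small_trans)
  then show ?thesis by (drule_tac smalloD_tendsto) simp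
qed

lemma bigo_power_le:
  fixes g :: "'a \<Rightarrow> 'b :: real_normed_field"
  assumes "(g \<longlongrightarrow> 0) F" "j \<le> k" "f \<in> O[F](\<lambda>x. g x ^ k)"
  shows "f \<in> O[F](\<lambda>x. g x ^ j)"
proof -
  have "g \<in> O[F](\<lambda>_. 1)" using assms(1) by (intro bigoI_tendsto[where c = 0]) auto
  then have "(\<lambda>x. g x ^ (k - j)) \<in> O[F](\<lambda>_. 1 ^ (k - j))" by (rule landau_o.big_power)
  then have "(\<lambda>x. g x ^ j * g x ^ (k - j)) \<in> O[F](\<lambda>x. g x ^ j * 1)"
    by (intro landau_o.big.mult) auto
  then show ?thesis using assms(2,3)
    by (auto simp flip: power_add intro: landau_o.big_trans)
qed

text \<open>
  On the branch at \<open>\<omega>\<close> one has \<open>ln (q / \<omega>) = \<mu> * log_coeff1 n \<omega> + \<mu>^2 * log_coeff2 n \<omega> + O(\<mu>^3)\<close>.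
\<close>

definition log_coeff1 :: "nat \<Rightarrow> complex \<Rightarrow> complex" where
  "log_coeff1 n \<omega> = of_real (1 - 1 / real n) * cnj \<omega> - (cnj \<omega>)\<^sup>2 + of_real (1 / real n)"

definition log_coeff2 :: "nat \<Rightarrow> complex \<Rightarrow> complex" where
  "log_coeff2 n \<omega> = (of_nat n - 1) * (cnj \<omega> - (cnj \<omega>)\<^sup>2) * log_coeff1 n \<omega> - of_nat (n + 1) * (log_coeff1 n \<omega>)\<^sup>2 / 2"

lemma norm_unity_root:
  fixes \<omega> :: complex
  assumes "\<omega> ^ (n + 1) = 1"
  shows "norm \<omega> = 1"
  using assms by (metis Suc_eq_plus1 norm_ge_zero norm_one norm_power power_eq_imp_eq_base power_one zero_less_Suc zero_le_one)

text \<open>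
  Since \<open>\<omega> ^ (n + 1) = 1\<close>, the powers \<open>\<omega> ^ n\<close> and \<open>\<omega> ^ (n - 1)\<close> are \<open>cnj \<omega>\<close> and its square.  This
  makes all later coefficients trigonometric polynomials of fixed degree in \<open>\<omega>\<close>.
\<close>

lemma drift_on_branch:
  assumes "n \<ge> 1" "\<omega> ^ (n + 1) = 1"
  shows "drift n (\<omega> * exp t) = of_nat (n + 1) * (of_real (1 - 1 / real n) * (cnj \<omega> * exp (of_nat n * t) - 1)
           - ((cnj \<omega>)\<^sup>2 * exp (of_nat (n - 1) * t) - 1))"
proof -
  have w: "\<omega> * cnj \<omega> = 1"
    using norm_unity_root[OF assms(2)] by (metis complex_norm_square of_real_1 power_one)
  have *: "cnj \<omega> = \<omega> ^ n"
  proof -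
    have "cnj \<omega> = \<omega> ^ (n + 1) * cnj \<omega>" using assms by simp
    also have "\<dots> = \<omega> ^ n * (\<omega> * cnj \<omega>)" by (simp only: power_add power_one_right mult_ac)
    finally show ?thesis using w by simp
  qed
  have **: "(cnj \<omega>)\<^sup>2 = \<omega> ^ (n - 1)"
  proof -
    have "\<omega> ^ (n - 1) = \<omega> ^ (n - 1) * \<omega> * cnj \<omega>" by (simp only: mult.assoc w mult_1_right)
    also have "\<omega> ^ (n - 1) * \<omega> = \<omega> ^ n" using assms(1) by (metis power_minus_mult zero_less_one less_le_trans)
    finally show ?thesis by (simp add: * power2_eq_square)
  qed
  show ?thesis unfolding drift_def * power_mult_distrib
    using ** * by (simp add: exp_of_nat_mult)
qed

text \<open>
  A bootstrap: boundedness of \<open>drift\<close> gives \<open>\<tau> = O(e)\<close>; with this, the first order Taylor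
  polynomial of \<open>drift\<close> at \<open>\<omega>\<close> gives \<open>\<tau>\<close> up to \<open>O(e^2)\<close>; inserting that once more gives \<open>\<tau>\<close> up to
  \<open>O(e^3)\<close>.  The filter is arbitrary because it will range over pairs of a parameter \<open>e\<close> and a
  root \<open>q\<close>, so that the estimates are uniform in the root.
\<close>

lemma root_log_expansion:
  fixes F :: "'a filter" and q :: "'a \<Rightarrow> complex" and e \<mu> :: "'a \<Rightarrow> real" and \<tau> :: "'a \<Rightarrow> complex"
  assumes n: "n \<ge> 1" and \<omega>: "\<omega> ^ (n + 1) = 1"
    and e: "(e \<longlongrightarrow> 0) F" and \<mu>: "\<mu> \<in> O[F](e)"
    and \<tau>: "\<And>x. \<tau> x = Ln (1 + of_real (\<mu> x) * drift n (q x)) / of_nat (n + 1)"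
    and q: "\<forall>\<^sub>F x in F. q x = \<omega> * exp (\<tau> x)" and q2: "\<forall>\<^sub>F x in F. norm (q x) \<le> 2"
  defines "E \<equiv> \<lambda>x. complex_of_real (e x)"
  shows "\<tau> \<in> O[F](E)"
    and "(\<lambda>x. \<tau> x - of_real (\<mu> x) * log_coeff1 n \<omega>) \<in> O[F](\<lambda>x. E x ^ 2)"
    and "(\<lambda>x. \<tau> x - (of_real (\<mu> x) * log_coeff1 n \<omega> + (of_real (\<mu> x))\<^sup>2 * log_coeff2 n \<omega>)) \<in> O[F](\<lambda>x. E x ^ 3)"
proof -
  define M where "M = (\<lambda>x. complex_of_real (\<mu> x))"
  define \<delta> where "\<delta> = (\<lambda>x. M x * drift n (q x))"
  define a where "a = log_coeff1 n \<omega>"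
  define v where "v = cnj \<omega>"
  define N where "N = (of_nat (n + 1) :: complex)"
  have N0: "N \<noteq> 0" unfolding N_def by (simp del: of_nat_Suc)
  have E0: "(E \<longlongrightarrow> 0) F"
    using tendsto_of_real[OF e, where 'a = complex] by (simp add: E_def)
  note down = bigo_power_le[OF E0]
  have M: "M \<in> O[F](E)" unfolding M_def E_def using \<mu> by (simp add: landau_o.big.of_real_iff)
  have "(\<lambda>x. drift n (q x)) \<in> O[F](\<lambda>_. 1)"
    by (rule bigoI[of _ "4 * real (n + 1) * 2 ^ n"], rule eventually_mono[OF q2])
       (use norm_drift_le[OF n, of _ 2] in simp)
  then have \<delta>: "\<delta> \<in> O[F](E)"
    unfolding \<delta>_def using landau_o.big.mult[OF M, of "\<lambda>x. drift n (q x)" "\<lambda>_. 1"] by simp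
  have \<delta>2: "(\<lambda>x. \<delta> x ^ 2) \<in> O[F](\<lambda>x. E x ^ 2)" using \<delta> by (rule landau_o.big_power)
  have \<delta>3: "(\<lambda>x. \<delta> x ^ 3) \<in> O[F](\<lambda>x. E x ^ 3)" using \<delta> by (rule landau_o.big_power)
  have "\<forall>\<^sub>F x in F. norm (\<delta> x) < 1 / 2"
    using tendsto_norm[OF bigo_tendsto_0[OF \<delta> E0]] by (intro order_tendstoD(2)[where y = 0]) auto
  then have "(\<lambda>x. Ln (1 + \<delta> x) - (\<delta> x - \<delta> x ^ 2 / 2)) \<in> O[F](\<lambda>x. \<delta> x ^ 3)"
    by (intro bigoI[of _ 15]) (auto elim!: eventually_mono simp: norm_power intro!: norm_Ln_second_order)
  from landau_o.big_trans[OF this \<delta>3]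
  have L: "(\<lambda>x. N * \<tau> x - (\<delta> x - \<delta> x ^ 2 / 2)) \<in> O[F](\<lambda>x. E x ^ 3)"
    using N0 by (simp add: \<tau> \<delta>_def M_def N_def del: of_nat_Suc of_nat_add)
  have c: "f \<in> O[F](g) \<Longrightarrow> (\<lambda>x. k * f x) \<in> O[F](g)" for k :: complex and f g :: "'a \<Rightarrow> complex"
    by (cases "k = 0") auto
  have N\<tau>: "(\<lambda>x. N * \<tau> x - \<delta> x) \<in> O[F](\<lambda>x. E x ^ 2)"
    using sum_in_bigo(2)[OF down[OF _ L, of 2] c[OF \<delta>2, of "1/2"]] by (simp add: algebra_simps)
  have "(\<lambda>x. N * \<tau> x) \<in> O[F](E)"
    using sum_in_bigo(1)[OF down[OF _ N\<tau>, of 1] _, of \<delta>] \<delta> by simp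
  then show \<tau>1: "\<tau> \<in> O[F](E)" using N0 by simp
  then have \<tau>0: "(\<tau> \<longlongrightarrow> 0) F" using E0 by (rule bigo_tendsto_0)
  have X: "(\<lambda>x. exp (of_nat k * \<tau> x) - 1 - of_nat k * \<tau> x) \<in> O[F](\<lambda>x. E x ^ 2)" for k
  proof -
    have "((\<lambda>x. of_nat k * \<tau> x) \<longlongrightarrow> 0) F" using tendsto_mult_left[OF \<tau>0, of "of_nat k"] by simp
    from exp_Taylor_bigo[OF this, of 1]
    have "(\<lambda>x. exp (of_nat k * \<tau> x) - 1 - of_nat k * \<tau> x) \<in> O[F](\<lambda>x. (of_nat k * \<tau> x) ^ 2)"
      by (simp add: numeral_2_eq_2 diff_diff_eq)
    also have "(\<lambda>x. (of_nat k * \<tau> x) ^ 2) \<in> O[F](\<lambda>x. E x ^ 2)"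
      by (intro landau_o.big_power c \<tau>1)
    finally show ?thesis .
  qed
  define s where "s = complex_of_real (1 - 1 / real n)"
  \<comment> \<open>The derivative of \<open>drift n (\<omega> * exp t) / (n + 1)\<close> with respect to \<open>t\<close> at \<open>t = 0\<close>.\<close>
  define l where "l = (of_nat n - 1) * (v - v\<^sup>2)"
  have sn: "s * of_nat n = of_nat n - 1" using n by (simp add: s_def field_simps)
  have sa: "a = s * v - v\<^sup>2 + 1 - s" by (simp add: a_def log_coeff1_def s_def v_def)
  have "(\<lambda>x. N * s * v * (exp (of_nat n * \<tau> x) - 1 - of_nat n * \<tau> x)
          - N * v\<^sup>2 * (exp (of_nat (n - 1) * \<tau> x) - 1 - of_nat (n - 1) * \<tau> x)) \<in> O[F](\<lambda>x. E x ^ 2)"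
    by (rule sum_in_bigo(2)[OF c[OF X] c[OF X]])
  also have "?this \<longleftrightarrow> (\<lambda>x. drift n (q x) - N * (a + l * \<tau> x)) \<in> O[F](\<lambda>x. E x ^ 2)"
  proof (rule landau_o.big.in_cong, rule eventually_mono[OF q])
    fix x assume qx: "q x = \<omega> * exp (\<tau> x)"
    have n1: "of_nat (n - 1) = (of_nat n - 1 :: complex)" using n by simp
    have "drift n (q x) - N * (a + l * \<tau> x)
       - (N * s * v * (exp (of_nat n * \<tau> x) - 1 - of_nat n * \<tau> x)
          - N * v\<^sup>2 * (exp (of_nat (n - 1) * \<tau> x) - 1 - of_nat (n - 1) * \<tau> x))
      = N * v * \<tau> x * (s * of_nat n - (of_nat n - 1))"
      unfolding qx drift_on_branch[OF n \<omega>] s_def[symmetric] v_def[symmetric] N_def[symmetric] sa l_def n1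
      by (simp add: algebra_simps power2_eq_square)
    also have "\<dots> = 0" by (simp add: sn)
    finally show "N * s * v * (exp (of_nat n * \<tau> x) - 1 - of_nat n * \<tau> x)
          - N * v\<^sup>2 * (exp (of_nat (n - 1) * \<tau> x) - 1 - of_nat (n - 1) * \<tau> x) = drift n (q x) - N * (a + l * \<tau> x)"
      by simp
  qed
  finally have "(\<lambda>x. M x * (drift n (q x) - N * (a + l * \<tau> x))) \<in> O[F](\<lambda>x. E x * E x ^ 2)"
    by (rule landau_o.big.mult[OF M])
  then have D: "(\<lambda>x. \<delta> x - N * (M x * a + l * (M x * \<tau> x))) \<in> O[F](\<lambda>x. E x ^ 3)"
    by (simp add: \<delta>_def algebra_simps power2_eq_square power3_eq_cube)
  have M\<tau>: "(\<lambda>x. M x * \<tau> x) \<in> O[F](\<lambda>x. E x ^ 2)"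
    using landau_o.big.mult[OF M \<tau>1] by (simp add: power2_eq_square)
  have \<delta>a: "(\<lambda>x. \<delta> x - N * a * M x) \<in> O[F](\<lambda>x. E x ^ 2)"
    using sum_in_bigo(1)[OF down[OF _ D, of 2] c[OF M\<tau>, of "N * l"]] by (simp add: algebra_simps)
  have "(\<lambda>x. N * (\<tau> x - M x * a)) \<in> O[F](\<lambda>x. E x ^ 2)"
    using sum_in_bigo(1)[OF N\<tau> \<delta>a] by (simp add: algebra_simps)
  then show \<tau>2: "(\<lambda>x. \<tau> x - of_real (\<mu> x) * log_coeff1 n \<omega>) \<in> O[F](\<lambda>x. E x ^ 2)"
    using N0 by (simp add: M_def a_def)
  have "(\<lambda>x. (\<delta> x - N * a * M x) * (\<delta> x + N * a * M x)) \<in> O[F](\<lambda>x. E x ^ 2 * E x)"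
    by (rule landau_o.big.mult[OF \<delta>a sum_in_bigo(1)[OF \<delta> c[OF M]]])
  then have \<delta>sq: "(\<lambda>x. (\<delta> x)\<^sup>2 - (N * a * M x)\<^sup>2) \<in> O[F](\<lambda>x. E x ^ 3)"
    by (simp add: algebra_simps power2_eq_square power3_eq_cube)
  have "(\<lambda>x. M x * (\<tau> x - M x * a)) \<in> O[F](\<lambda>x. E x * E x ^ 2)"
    using landau_o.big.mult[OF M \<tau>2] by (simp add: M_def a_def)
  then have Ml: "(\<lambda>x. M x * (\<tau> x - M x * a)) \<in> O[F](\<lambda>x. E x ^ 3)"
    by (simp add: power2_eq_square power3_eq_cube mult.assoc)
  have "(\<lambda>x. (N * \<tau> x - (\<delta> x - \<delta> x ^ 2 / 2)) + (\<delta> x - N * (M x * a + l * (M x * \<tau> x)))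
        + N * l * (M x * (\<tau> x - M x * a)) - (1 / 2) * ((\<delta> x)\<^sup>2 - (N * a * M x)\<^sup>2)) \<in> O[F](\<lambda>x. E x ^ 3)"
    by (rule sum_in_bigo(2)[OF sum_in_bigo(1)[OF sum_in_bigo(1)[OF L D] c[OF Ml]] c[OF \<delta>sq]])
  also have "(\<lambda>x. (N * \<tau> x - (\<delta> x - \<delta> x ^ 2 / 2)) + (\<delta> x - N * (M x * a + l * (M x * \<tau> x)))
        + N * l * (M x * (\<tau> x - M x * a)) - (1 / 2) * ((\<delta> x)\<^sup>2 - (N * a * M x)\<^sup>2))
      = (\<lambda>x. N * (\<tau> x - (M x * a + (M x)\<^sup>2 * (l * a - N * a\<^sup>2 / 2))))"
    by (rule ext) (simp add: field_simps power2_eq_square)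
  finally show "(\<lambda>x. \<tau> x - (of_real (\<mu> x) * log_coeff1 n \<omega> + (of_real (\<mu> x))\<^sup>2 * log_coeff2 n \<omega>)) \<in> O[F](\<lambda>x. E x ^ 3)"
    using N0 by (simp add: M_def a_def l_def v_def N_def log_coeff2_def del: of_nat_Suc of_nat_add)
qed

text \<open>\<open>(norm q)^2\<close> is \<open>exp (2 * Re \<tau>)\<close>, so only the real part of the expansion of \<open>\<tau>\<close> matters.\<close>

lemma root_modulus_expansion:
  fixes F :: "'a filter" and q :: "'a \<Rightarrow> complex" and e \<mu> :: "'a \<Rightarrow> real"
  assumes n: "n \<ge> 1" and \<omega>: "\<omega> ^ (n + 1) = 1"
    and e: "(e \<longlongrightarrow> 0) F" and \<mu>: "\<mu> \<in> O[F](e)"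
    and q: "\<forall>\<^sub>F x in F. q x = \<omega> * exp (Ln (1 + of_real (\<mu> x) * drift n (q x)) / of_nat (n + 1))"
    and q2: "\<forall>\<^sub>F x in F. norm (q x) \<le> 2"
  defines "a \<equiv> log_coeff1 n \<omega>"
  shows "(\<lambda>x. (norm (q x))\<^sup>2 - 1 - (2 * Re a * \<mu> x + 2 * (Re (log_coeff2 n \<omega>) + (Re a)\<^sup>2) * (\<mu> x)\<^sup>2)) \<in> O[F](\<lambda>x. e x ^ 3)"
    and "(\<lambda>x. Re (q x) - (Re \<omega> + Re (\<omega> * a) * \<mu> x)) \<in> O[F](\<lambda>x. e x ^ 2)"
proof -
  define \<tau> where "\<tau> = (\<lambda>x. Ln (1 + of_real (\<mu> x) * drift n (q x)) / of_nat (n + 1))"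
  note down = bigo_power_le[OF e]
  have q': "\<forall>\<^sub>F x in F. q x = \<omega> * exp (\<tau> x)" using q by (simp add: \<tau>_def)
  note expn = root_log_expansion[OF n \<omega> e \<mu> _ q' q2, OF fun_cong[OF \<tau>_def]]
  have \<omega>1: "norm \<omega> = 1" using \<omega> by (rule norm_unity_root)
  define t where "t = (\<lambda>x. Re (\<tau> x))"
  have t1: "t \<in> O[F](e)" unfolding t_def by (rule Re_bigo[OF expn(1)])
  have t2: "(\<lambda>x. t x - Re a * \<mu> x) \<in> O[F](\<lambda>x. e x ^ 2)"
    using Re_bigo[of _ F "\<lambda>x. e x ^ 2"] expn(2) by (force simp: t_def a_def mult_ac)
  have t3: "(\<lambda>x. t x - (Re a * \<mu> x + Re (log_coeff2 n \<omega>) * (\<mu> x)\<^sup>2)) \<in> O[F](\<lambda>x. e x ^ 3)"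
    using Re_bigo[of _ F "\<lambda>x. e x ^ 3"] expn(3) by (force simp: t_def a_def mult_ac simp flip: of_real_power)
  have c: "f \<in> O[F](g) \<Longrightarrow> (\<lambda>x. k * f x) \<in> O[F](g)" for k :: real and f g :: "'a \<Rightarrow> real"
    by (cases "k = 0") auto
  have "(\<lambda>x. (t x - Re a * \<mu> x) * (t x + Re a * \<mu> x)) \<in> O[F](\<lambda>x. e x ^ 2 * e x)"
    by (rule landau_o.big.mult[OF t2 sum_in_bigo(1)[OF t1 c[OF \<mu>]]])
  then have tt: "(\<lambda>x. (t x - Re a * \<mu> x) * (t x + Re a * \<mu> x)) \<in> O[F](\<lambda>x. e x ^ 3)"
    by (simp add: power2_eq_square power3_eq_cube mult.assoc)
  have "((\<lambda>x. 2 * t x) \<longlongrightarrow> 0) F" using tendsto_mult_left[OF bigo_tendsto_0[OF t1 e], of 2] by simp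
  from exp_Taylor_bigo[OF this, of 2]
  have "(\<lambda>x. exp (2 * t x) - 1 - 2 * t x - 2 * (t x)\<^sup>2) \<in> O[F](\<lambda>x. (2 * t x) ^ 3)"
    by (simp add: numeral_2_eq_2 numeral_3_eq_3 diff_diff_eq algebra_simps)
  also have "(\<lambda>x. (2 * t x) ^ 3) \<in> O[F](\<lambda>x. e x ^ 3)"
    by (intro landau_o.big_power c t1)
  finally have ee: "(\<lambda>x. exp (2 * t x) - 1 - 2 * t x - 2 * (t x)\<^sup>2) \<in> O[F](\<lambda>x. e x ^ 3)" .
  have "(\<lambda>x. (exp (2 * t x) - 1 - 2 * t x - 2 * (t x)\<^sup>2)
      + 2 * (t x - (Re a * \<mu> x + Re (log_coeff2 n \<omega>) * (\<mu> x)\<^sup>2))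
      + 2 * ((t x - Re a * \<mu> x) * (t x + Re a * \<mu> x))) \<in> O[F](\<lambda>x. e x ^ 3)"
    by (rule sum_in_bigo(1)[OF sum_in_bigo(1)[OF ee c[OF t3]] c[OF tt]])
  also have "?this \<longleftrightarrow> (\<lambda>x. (norm (q x))\<^sup>2 - 1 - (2 * Re a * \<mu> x + 2 * (Re (log_coeff2 n \<omega>) + (Re a)\<^sup>2) * (\<mu> x)\<^sup>2)) \<in> O[F](\<lambda>x. e x ^ 3)"
  proof (rule landau_o.big.in_cong, rule eventually_mono[OF q'])
    fix x assume qx: "q x = \<omega> * exp (\<tau> x)"
    have "(norm (q x))\<^sup>2 = exp (2 * t x)"
      unfolding qx by (simp add: norm_mult \<omega>1 t_def exp_double)
    then show "(exp (2 * t x) - 1 - 2 * t x - 2 * (t x)\<^sup>2)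
      + 2 * (t x - (Re a * \<mu> x + Re (log_coeff2 n \<omega>) * (\<mu> x)\<^sup>2))
      + 2 * ((t x - Re a * \<mu> x) * (t x + Re a * \<mu> x))
      = (norm (q x))\<^sup>2 - 1 - (2 * Re a * \<mu> x + 2 * (Re (log_coeff2 n \<omega>) + (Re a)\<^sup>2) * (\<mu> x)\<^sup>2)"
      by (simp add: algebra_simps power2_eq_square)
  qed
  finally show "(\<lambda>x. (norm (q x))\<^sup>2 - 1 - (2 * Re a * \<mu> x + 2 * (Re (log_coeff2 n \<omega>) + (Re a)\<^sup>2) * (\<mu> x)\<^sup>2)) \<in> O[F](\<lambda>x. e x ^ 3)" .
  define E where "E = (\<lambda>x. complex_of_real (e x))"
  have E0: "(E \<longlongrightarrow> 0) F"
    using tendsto_of_real[OF e, where 'a = complex] by (simp add: E_def)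
  have \<tau>1: "\<tau> \<in> O[F](E)" using expn(1) by (simp add: E_def)
  have cc: "f \<in> O[F](g) \<Longrightarrow> (\<lambda>x. k * f x) \<in> O[F](g)" for k :: complex and f g :: "'a \<Rightarrow> complex"
    by (cases "k = 0") auto
  from exp_Taylor_bigo[OF bigo_tendsto_0[OF \<tau>1 E0], of 1]
  have "(\<lambda>x. exp (\<tau> x) - 1 - \<tau> x) \<in> O[F](\<lambda>x. \<tau> x ^ 2)"
    by (simp add: numeral_2_eq_2 diff_diff_eq)
  also have "(\<lambda>x. \<tau> x ^ 2) \<in> O[F](\<lambda>x. E x ^ 2)" by (intro landau_o.big_power \<tau>1)
  finally have "(\<lambda>x. exp (\<tau> x) - 1 - \<tau> x) \<in> O[F](\<lambda>x. E x ^ 2)" .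
  moreover have "(\<lambda>x. \<tau> x - of_real (\<mu> x) * log_coeff1 n \<omega>) \<in> O[F](\<lambda>x. E x ^ 2)"
    using expn(2) by (simp only: E_def)
  ultimately have "(\<lambda>x. \<omega> * (exp (\<tau> x) - 1 - \<tau> x) + \<omega> * (\<tau> x - of_real (\<mu> x) * log_coeff1 n \<omega>)) \<in> O[F](\<lambda>x. E x ^ 2)"
    by (rule sum_in_bigo(1)[OF cc cc])
  then
  have "(\<lambda>x. \<omega> * (exp (\<tau> x) - 1 - \<tau> x) + \<omega> * (\<tau> x - of_real (\<mu> x) * a)) \<in> O[F](\<lambda>x. E x ^ 2)"
    by (simp add: a_def)
  then have "(\<lambda>x. Re (\<omega> * (exp (\<tau> x) - 1 - \<tau> x) + \<omega> * (\<tau> x - of_real (\<mu> x) * a))) \<in> O[F](\<lambda>x. e x ^ 2)"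
    by (intro Re_bigo) (simp add: E_def)
  also have "?this \<longleftrightarrow> (\<lambda>x. Re (q x) - (Re \<omega> + Re (\<omega> * a) * \<mu> x)) \<in> O[F](\<lambda>x. e x ^ 2)"
    by (rule landau_o.big.in_cong, rule eventually_mono[OF q']) (simp add: algebra_simps)
  finally show "(\<lambda>x. Re (q x) - (Re \<omega> + Re (\<omega> * a) * \<mu> x)) \<in> O[F](\<lambda>x. e x ^ 2)" .
qed

section \<open>The modulus of a root up to third order\<close>

text \<open>
  The identity behind \<open>D3\<close>, ..., \<open>D6\<close>.  The left-hand side is \<open>H(u) / (1 - u)\<close>, with the constant
  \<open>1\<close> of \<open>H\<close> rewritten by the first order relation.  As a cubic in \<open>X\<close> instead of \<open>u\<close>, reduced
  modulo \<open>(X - u) (X - v)\<close>, it becomes a linear polynomial.  Its coefficient of \<open>X\<close> contains \<open>m2\<close>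
  as \<open>4 * m2\<close> and does not contain \<open>D\<close>, so its vanishing determines \<open>m2\<close>; the constant coefficient
  then determines \<open>D\<close>.  Both are symmetric in \<open>u\<close> and \<open>v\<close>, so the same \<open>m2\<close> and \<open>D\<close> serve
  both tight roots.
\<close>

lemma balance_identity:
  fixes u v m N y :: real
  assumes 1: "2 * m * (1 - u) * (1 - v) = 1" and 2: "N * y = 1"
    and d1: "d1 = - (2 * u * v + 1) * m" and d2: "d2 = - m" and c: "c = d1 + d2 * y"
    and D: "D = (- 1 - 4 * d1 - 3 * d1\<^sup>2 + 2 * d2\<^sup>2) / 2 * N + (3 * d1 - 4 * d2 + 3 * d1\<^sup>2 - 2 * d1 * d2 - 6 * d2\<^sup>2) / 2
       + (2 + 4 * d1 + 5 * d2 + 2 * d1\<^sup>2 + 4 * d1 * d2 + 3 * d2\<^sup>2) / 2 * y + (2 * d2 + 2 * d1 * d2 + 3 * d2\<^sup>2) / 2 * y\<^sup>2"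
    and m2: "m2 = - (m\<^sup>2 * (16 - 8 * N) * ((u + v)\<^sup>2 - u * v) + 8 * y * m\<^sup>2 * (u + v)
       + m\<^sup>2 * (6 * N - 12 + 6 * y) + 8 * c * m + 2 * m) / 4"
  shows "2 * m2 * (2 * u + 1 + y)
     + m\<^sup>2 * (2 * (N - 1) * (- 8 * u ^ 3 - 4 * y * u\<^sup>2 + 6 * u + 2 * y) - (N + 1) * (- 8 * u ^ 3 - 8 * y * u\<^sup>2 + (6 - 2 * y\<^sup>2) * u + 4 * y)
        + 2 * (1 - u) * (2 * u + 1 + y)\<^sup>2)
     + 4 * c * m * (2 * u + 1 + y) + 2 * D + 2 * c * (1 + c) - 2 * (1 + c) * m * (1 - y) + m * (2 * u + 1 + y) + 1 + c = 0"
  using 1 2 unfolding m2 D c d1 d2 by algebra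


text \<open>
  The coefficient of \<open>\<mu>^2\<close> in \<open>(norm q)^2\<close> on the branch at \<open>\<omega>\<close>, as a polynomial in \<open>u = Re \<omega>\<close>
  and divided by \<open>1 - u\<close>; the factor \<open>1 - u\<close> splits off because \<open>q = 1\<close> is a root for every \<open>\<mu>\<close>.
\<close>

definition quad_coeff :: "nat \<Rightarrow> real \<Rightarrow> real" where
  "quad_coeff n u = 2 * (real n - 1) * (- 8 * u ^ 3 - 4 * (1 / real n) * u\<^sup>2 + 6 * u + 2 * (1 / real n))
     - (real n + 1) * (- 8 * u ^ 3 - 8 * (1 / real n) * u\<^sup>2 + (6 - 2 * (1 / real n)\<^sup>2) * u + 4 * (1 / real n))
     + 2 * (1 - u) * (2 * u + 1 + 1 / real n)\<^sup>2"

lemma Re_log_coeffs: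
  assumes \<omega>: "norm \<omega> = 1"
  defines "u \<equiv> Re \<omega>"
  shows "Re (log_coeff1 n \<omega>) = (1 - u) * (2 * u + 1 + 1 / real n)"
    and "2 * (Re (log_coeff2 n \<omega>) + (Re (log_coeff1 n \<omega>))\<^sup>2) = (1 - u) * quad_coeff n u"
    and "Re (\<omega> * log_coeff1 n \<omega>) = (1 - 1 / real n) * (1 - u)"
proof -
  define w where "w = Im \<omega>"
  define y where "y = 1 / real n"
  have w2: "w * w = 1 - u * u"
    using \<omega> by (simp add: cmod_def u_def w_def power2_eq_square algebra_simps)
  have re: "Re (log_coeff1 n \<omega>) = (1 - y) * u - (u * u - w * w) + y"
    and im: "Im (log_coeff1 n \<omega>) = - (1 - y) * w + 2 * u * w"
    by (simp_all add: log_coeff1_def u_def w_def y_def power2_eq_square algebra_simps)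
  show 1: "Re (log_coeff1 n \<omega>) = (1 - u) * (2 * u + 1 + 1 / real n)"
    unfolding re w2 y_def[symmetric] by algebra
  have "Re (\<omega> * log_coeff1 n \<omega>) = u * Re (log_coeff1 n \<omega>) - w * Im (log_coeff1 n \<omega>)"
    by (simp add: u_def w_def)
  also have "\<dots> = (1 - y) * (1 - u)"
    unfolding re im using w2 by algebra
  finally show "Re (\<omega> * log_coeff1 n \<omega>) = (1 - 1 / real n) * (1 - u)" by (simp add: y_def)
  have "Re (log_coeff2 n \<omega>) =
      (real n - 1) * ((u - (u * u - w * w)) * Re (log_coeff1 n \<omega>) - (- w + 2 * u * w) * Im (log_coeff1 n \<omega>))
      - (real n + 1) * (Re (log_coeff1 n \<omega>) * Re (log_coeff1 n \<omega>) - Im (log_coeff1 n \<omega>) * Im (log_coeff1 n \<omega>)) / 2"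
    by (simp add: log_coeff2_def u_def w_def power2_eq_square algebra_simps)
  then show "2 * (Re (log_coeff2 n \<omega>) + (Re (log_coeff1 n \<omega>))\<^sup>2) = (1 - u) * quad_coeff n u"
    unfolding quad_coeff_def y_def[symmetric] re im using w2 by algebra
qed

text \<open>
  This is \<open>|z|^2 - 1\<close> at \<open>z = \<beta> + R (q - 1)\<close>, arranged so that \<open>(norm q)^2 - 1\<close> is the only place
  where \<open>q\<close> is needed to third order: \<open>Re q\<close> carries the small factor \<open>R - \<beta>\<close>.
\<close>

definition excess :: "real \<Rightarrow> real \<Rightarrow> complex \<Rightarrow> real" where
  "excess R \<beta> q = R\<^sup>2 * ((norm q)\<^sup>2 - 1) + 2 * R * (R - \<beta>) * (1 - Re q) + \<beta>\<^sup>2 - 1"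

lemma excess_eq: "excess R \<beta> q = (norm (of_real \<beta> + of_real R * (q - 1)))\<^sup>2 - 1"
  unfolding excess_def cmod_power2 by (simp add: power2_eq_square algebra_simps)

definition radius :: "real \<Rightarrow> real \<Rightarrow> real \<Rightarrow> real \<Rightarrow> real" where
  "radius c D K e = 1 + c * e + D * e\<^sup>2 - K * e ^ 3"

lemma excess_expansion:
  fixes F :: "'a filter" and q :: "'a \<Rightarrow> complex" and e :: "'a \<Rightarrow> real" and c D d m m2 A k w :: real
  assumes e: "(e \<longlongrightarrow> 0) F"
    and p: "(\<lambda>x. (norm (q x))\<^sup>2 - 1 - (2 * A * (m * e x + m2 * (e x)\<^sup>2) + k * (m * e x + m2 * (e x)\<^sup>2)\<^sup>2)) \<in> O[F](\<lambda>x. e x ^ 3)"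
    and r: "(\<lambda>x. Re (q x) - (1 - d + w * (m * e x + m2 * (e x)\<^sup>2))) \<in> O[F](\<lambda>x. e x ^ 2)"
  defines "G \<equiv> 2 * A * m + 2 * d * (1 + c) - 2"
    and "H \<equiv> 2 * A * m2 + k * m\<^sup>2 + 4 * A * c * m + 2 * d * (D + c * (1 + c)) - 2 * w * m * (1 + c) + 1"
  shows "(\<lambda>x. excess (radius c D 0 (e x)) (1 - e x) (q x) - (G * e x + H * (e x)\<^sup>2)) \<in> O[F](\<lambda>x. e x ^ 3)"
proof -
  define h where "h = (\<lambda>t. m + m2 * t)"
  define s where "s = (\<lambda>t. c + D * t)"
  define W where "W = (\<lambda>t. (1 + t * s t) * (1 + s t))"
  define T where "T = (\<lambda>t. k * (2 * m * m2 + m2\<^sup>2 * t) + 4 * A * (D * m + c * m2 + D * m2 * t)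
      + 2 * s t * k * (h t)\<^sup>2 + 2 * (s t)\<^sup>2 * A * h t + t * (s t)\<^sup>2 * k * (h t)\<^sup>2
      + 2 * d * D * (1 + 2 * c + D * t)
      - 2 * w * (m2 * W t + m * (D + c * (1 + c)) + t * m * D * (1 + 2 * c + D * t)))"
  define R where "R = (\<lambda>t. 1 + t * s t)"
  define P where "P = (\<lambda>t. 2 * A * (m * t + m2 * t\<^sup>2) + k * (m * t + m2 * t\<^sup>2)\<^sup>2)"
  define Q where "Q = (\<lambda>t. 1 - d + w * (m * t + m2 * t\<^sup>2))"
  have rad: "radius c D 0 t = R t" for t
    by (simp add: radius_def R_def s_def algebra_simps power2_eq_square)
  \<comment> \<open>The expansions of \<open>(norm q)^2 - 1\<close> and \<open>Re q\<close> turn the excess into a polynomial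
      in \<open>t\<close>; its terms of order three and higher are \<open>t ^ 3 * T t\<close>.\<close>
  have poly: "(R t)\<^sup>2 * P t + 2 * R t * (R t - (1 - t)) * (1 - Q t) + (1 - t)\<^sup>2 - 1 - (G * t + H * t\<^sup>2) = t ^ 3 * T t" for t
    unfolding R_def P_def Q_def T_def G_def H_def W_def s_def h_def by algebra
  have Rl: "((\<lambda>x. R (e x)) \<longlongrightarrow> 1 + 0 * (c + D * 0)) F"
    unfolding R_def s_def by (intro tendsto_intros e)
  have "(\<lambda>x. (R (e x))\<^sup>2) \<in> O[F](\<lambda>_. 1)"
    by (rule bigoI_tendsto[of _ _ 1]) (use tendsto_power[OF Rl, of 2] in auto)
  from landau_o.big.mult[OF this p]
  have 1: "(\<lambda>x. (R (e x))\<^sup>2 * ((norm (q x))\<^sup>2 - 1 - P (e x))) \<in> O[F](\<lambda>x. e x ^ 3)"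
    by (simp add: P_def)
  have "((\<lambda>x. 2 * R (e x) * (1 + s (e x))) \<longlongrightarrow> 2 * (1 + 0 * (c + D * 0)) * (1 + (c + D * 0))) F"
    unfolding s_def by (intro tendsto_intros Rl e)
  then have "(\<lambda>x. 2 * R (e x) * (1 + s (e x))) \<in> O[F](\<lambda>_. 1)"
    by (intro bigoI_tendsto) auto
  from landau_o.big.mult[OF landau_o.big.mult[OF this landau_o.big_refl[of e]] r]
  have 2: "(\<lambda>x. 2 * R (e x) * (R (e x) - (1 - e x)) * (Re (q x) - Q (e x))) \<in> O[F](\<lambda>x. e x ^ 3)"
    by (simp add: Q_def R_def algebra_simps power2_eq_square power3_eq_cube)
  have "((\<lambda>x. T (e x)) \<longlongrightarrow> T 0) F"
    unfolding T_def W_def h_def s_def by (intro tendsto_intros e)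
  then have "(\<lambda>x. T (e x)) \<in> O[F](\<lambda>_. 1)"
    by (intro bigoI_tendsto) auto
  from landau_o.big.mult[OF landau_o.big_refl[of "\<lambda>x. e x ^ 3"] this]
  have 3: "(\<lambda>x. e x ^ 3 * T (e x)) \<in> O[F](\<lambda>x. e x ^ 3)" by simp
  from sum_in_bigo(2)[OF sum_in_bigo(1)[OF 1 3] 2]
  have "(\<lambda>x. (R (e x))\<^sup>2 * ((norm (q x))\<^sup>2 - 1 - P (e x)) + e x ^ 3 * T (e x)
       - 2 * R (e x) * (R (e x) - (1 - e x)) * (Re (q x) - Q (e x))) \<in> O[F](\<lambda>x. e x ^ 3)" .
  also have "(\<lambda>x. (R (e x))\<^sup>2 * ((norm (q x))\<^sup>2 - 1 - P (e x)) + e x ^ 3 * T (e x)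
       - 2 * R (e x) * (R (e x) - (1 - e x)) * (Re (q x) - Q (e x)))
     = (\<lambda>x. excess (radius c D 0 (e x)) (1 - e x) (q x) - (G * e x + H * (e x)\<^sup>2))"
    unfolding poly[symmetric] excess_def rad by (rule ext) algebra
  finally show ?thesis .
qed

text \<open>
  The roots \<open>q\<close> do not depend on the radius, so their expansion is not affected by changing it by
  \<open>- K * e ^ 3\<close>.  The effect on the excess is explicit, and it is negative to leading order.
\<close>

lemma excess_radius_shift:
  fixes F :: "'a filter" and q :: "'a \<Rightarrow> complex" and e :: "'a \<Rightarrow> real"
  assumes e: "(e \<longlongrightarrow> 0) F" and p: "((\<lambda>x. (norm (q x))\<^sup>2 - 1) \<longlongrightarrow> 0) F" and r: "((\<lambda>x. Re (q x)) \<longlongrightarrow> 1 - d) F"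
  obtains \<eta> where "(\<eta> \<longlongrightarrow> 0) F"
    "\<And>x. excess (radius c D K (e x)) (1 - e x) (q x) = excess (radius c D 0 (e x)) (1 - e x) (q x) + e x ^ 3 * (\<eta> x - 2 * K * d)"
proof
  define R where "R = (\<lambda>x. radius c D 0 (e x))"
  define \<eta> where "\<eta> = (\<lambda>x. 2 * K * d - K * (2 * R x - K * e x ^ 3) * ((norm (q x))\<^sup>2 - 1)
     - 2 * K * (2 * R x - 1 + e x - K * e x ^ 3) * (1 - Re (q x)))"
  have "(R \<longlongrightarrow> 1 + c * 0 + D * 0\<^sup>2 - 0 * 0 ^ 3) F"
    unfolding R_def radius_def by (intro tendsto_intros e)
  then have R: "(R \<longlongrightarrow> 1) F" by simp
  have "(\<eta> \<longlongrightarrow> 2 * K * d - K * (2 * 1 - K * 0 ^ 3) * 0 - 2 * K * (2 * 1 - 1 + 0 - K * 0 ^ 3) * (1 - (1 - d))) F"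
    unfolding \<eta>_def by (intro tendsto_intros R e p r)
  then show "(\<eta> \<longlongrightarrow> 0) F" by simp
  show "excess (radius c D K (e x)) (1 - e x) (q x) = excess (radius c D 0 (e x)) (1 - e x) (q x) + e x ^ 3 * (\<eta> x - 2 * K * d)" for x
  proof -
    have K: "radius c D K (e x) = R x - K * e x ^ 3" and "radius c D 0 (e x) = R x"
      by (simp_all add: R_def radius_def)
    then show ?thesis
      unfolding \<eta>_def excess_def by algebra
  qed
qed

text \<open>
  If \<open>G < 0\<close> the first order wins.  Otherwise only the error \<open>C * e ^ 3\<close> is left, and the gain
  \<open>2 * K * d * e ^ 3\<close> from the smaller radius exceeds it.
\<close>

lemma excess_eventually_nonpos:
  fixes F :: "'a filter" and q :: "'a \<Rightarrow> complex" and e :: "'a \<Rightarrow> real"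
  assumes e: "(e \<longlongrightarrow> 0) F" and pos: "\<forall>\<^sub>F x in F. e x > 0" and d: "d > 0"
    and p: "((\<lambda>x. (norm (q x))\<^sup>2 - 1) \<longlongrightarrow> 0) F" and r: "((\<lambda>x. Re (q x)) \<longlongrightarrow> 1 - d) F"
    and ex: "(\<lambda>x. excess (radius c D 0 (e x)) (1 - e x) (q x) - (G * e x + H * (e x)\<^sup>2)) \<in> O[F](\<lambda>x. e x ^ 3)"
    and GH: "G < 0 \<or> G = 0 \<and> H = 0"
  shows "\<exists>K0. \<forall>K\<ge>K0. \<forall>\<^sub>F x in F. excess (radius c D K (e x)) (1 - e x) (q x) \<le> 0"
proof -
  obtain C where C: "\<forall>\<^sub>F x in F. \<bar>excess (radius c D 0 (e x)) (1 - e x) (q x) - (G * e x + H * (e x)\<^sup>2)\<bar> \<le> C * \<bar>e x ^ 3\<bar>"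
    using ex by (auto simp: bigo_def)
  have "\<forall>\<^sub>F x in F. excess (radius c D K (e x)) (1 - e x) (q x) \<le> 0" if K: "K \<ge> (C + d) / (2 * d)" for K
  proof -
    obtain \<eta> where \<eta>: "(\<eta> \<longlongrightarrow> 0) F"
      "\<And>x. excess (radius c D K (e x)) (1 - e x) (q x) = excess (radius c D 0 (e x)) (1 - e x) (q x) + e x ^ 3 * (\<eta> x - 2 * K * d)"
      using excess_radius_shift[OF e p r] by metis
    have Kd: "C + d \<le> 2 * K * d" using K d by (simp add: field_simps)
    have \<eta>d: "\<forall>\<^sub>F x in F. \<eta> x < d" using \<eta>(1) d by (rule order_tendstoD(2))
    have GH': "\<forall>\<^sub>F x in F. G + H * e x \<le> 0"
    proof (cases "G < 0")
      case True
      have "((\<lambda>x. G + H * e x) \<longlongrightarrow> G + H * 0) F" by (intro tendsto_intros e)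
      then have "\<forall>\<^sub>F x in F. G + H * e x < 0" using True by (intro order_tendstoD(2)) auto
      then show ?thesis by eventually_elim simp
    qed (use GH in auto)
    show ?thesis using C \<eta>d GH' pos
    proof eventually_elim
      case (elim x)
      have "e x * (G + H * e x) \<le> 0" using elim by (intro mult_nonneg_nonpos) auto
      then have "G * e x + H * (e x)\<^sup>2 \<le> 0" by (simp add: algebra_simps power2_eq_square)
      then have "excess (radius c D 0 (e x)) (1 - e x) (q x) \<le> e x ^ 3 * C" using elim by (simp add: abs_le_iff mult.commute)
      then have "excess (radius c D K (e x)) (1 - e x) (q x) \<le> e x ^ 3 * (C + (\<eta> x - 2 * K * d))"
        unfolding \<eta>(2) distrib_left by simp
      also have "\<dots> \<le> 0" using elim Kd by (intro mult_nonneg_nonpos) auto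
      finally show ?case .
    qed
  qed
  then show ?thesis by blast
qed

text \<open>
  Dividing the equation by \<open>q - 1\<close> leaves a continuous function that takes the value \<open>n + 1\<close> at
  \<open>q = 1\<close>, \<open>\<mu> = 0\<close>.
\<close>

lemma branch_at_1_trivial:
  fixes F :: "'a filter" and q :: "'a \<Rightarrow> complex" and \<mu> :: "'a \<Rightarrow> real"
  assumes q: "(q \<longlongrightarrow> 1) F" and \<mu>: "(\<mu> \<longlongrightarrow> 0) F"
    and eq: "\<forall>\<^sub>F x in F. q x ^ (n + 1) = 1 + of_real (\<mu> x) * drift n (q x)"
  shows "\<forall>\<^sub>F x in F. q x = 1"
proof -
  define s where "s = complex_of_real (1 - 1 / real n)"
  define f where "f = (\<lambda>x. (\<Sum>i<n + 1. q x ^ i) - of_real (\<mu> x) * (of_nat (n + 1) *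
      (s * (\<Sum>i<n. q x ^ i) - (\<Sum>i<n - 1. q x ^ i))))"
  have "(f \<longlongrightarrow> (\<Sum>i<n + 1. 1 ^ i) - of_real 0 * (of_nat (n + 1) *
      (s * (\<Sum>i<n. 1 ^ i) - (\<Sum>i<n - 1. 1 ^ i)))) F"
    unfolding f_def by (intro tendsto_intros q \<mu>)
  then have "(f \<longlongrightarrow> of_nat (n + 1)) F" by simp
  then have "\<forall>\<^sub>F x in F. f x \<noteq> 0"
    by (rule tendsto_imp_eventually_ne) (simp del: of_nat_Suc of_nat_add)
  with eq show ?thesis
  proof eventually_elim
    case (elim x)
    have "(q x - 1) * f x = (q x ^ (n + 1) - 1) - of_real (\<mu> x) * drift n (q x)"
      unfolding f_def drift_def power_diff_1_eq s_def[symmetric] by (simp add: algebra_simps)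
    then show ?case using elim by simp
  qed
qed

section \<open>The two tight roots of unity\<close>

lemma kk_bounds:
  assumes "n \<ge> 3"
  obtains k :: nat where "kk n = int k" "1 \<le> k" "2 * (k + 1) \<le> n + 1"
proof
  have "(real n + 1) / 3 = real (n + 1) / real 3" by simp
  then show "kk n = int ((n + 1) div 3)"
    unfolding kk_def by (simp only: floor_divide_of_nat_eq)
  show "1 \<le> (n + 1) div 3" "2 * ((n + 1) div 3 + 1) \<le> n + 1" using assms by presburger+
qed

lemma Re_unity_root:
  assumes \<omega>: "\<omega> ^ (n + 1) = 1" "\<omega> \<noteq> 1"
  obtains j :: nat where "1 \<le> j" "2 * j \<le> n + 1" "Re \<omega> = cos (2 * pi * real j / (real n + 1))"
proof -
  have "(\<lambda>k. cis (2 * pi * real k / real (n + 1))) ` {..<n + 1} = {z. z ^ (n + 1) = 1}"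
    by (rule bij_betw_imp_surj_on[OF Complex.bij_betw_roots_unity]) simp
  with \<omega>(1) have "\<omega> \<in> (\<lambda>k. cis (2 * pi * real k / real (n + 1))) ` {..<n + 1}" by blast
  then obtain j where j: "j < n + 1" "\<omega> = cis (2 * pi * real j / real (n + 1))" by blast
  have "j \<noteq> 0" using j \<omega>(2) by (intro notI) simp
  have Re: "Re \<omega> = cos (2 * pi * real j / (real n + 1))" using j(2) by (simp add: add.commute)
  show ?thesis
  proof (cases "2 * j \<le> n + 1")
    case True
    then show ?thesis using that[of j] Re \<open>j \<noteq> 0\<close> by simp
  next
    case False
    have "2 * pi * real (n + 1 - j) / (real n + 1) = 2 * pi - 2 * pi * real j / (real n + 1)"
      using j(1) by (simp add: of_nat_diff field_simps)
    then have "cos (2 * pi * real (n + 1 - j) / (real n + 1)) = cos (2 * pi * real j / (real n + 1))"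
      by simp
    then show ?thesis using that[of "n + 1 - j"] Re j(1) False by simp
  qed
qed

lemma u1_u2:
  assumes "n \<ge> 3"
  shows "u1 n < 1" and "u2 n < u1 n"
    and "\<And>\<omega>. \<omega> ^ (n + 1) = 1 \<Longrightarrow> \<omega> \<noteq> 1 \<Longrightarrow> (Re \<omega> - u1 n) * (Re \<omega> - u2 n) \<ge> 0"
proof -
  obtain k where k: "kk n = int k" "1 \<le> k" "2 * (k + 1) \<le> n + 1" using kk_bounds[OF assms] .
  \<comment> \<open>On \<open>{0..pi}\<close> the cosine is antitone, and both \<open>\<theta> k\<close> and \<open>\<theta> (k + 1)\<close> lie there.\<close>
  define \<theta> where "\<theta> = (\<lambda>j. 2 * pi * real j / (real n + 1))"
  have mono: "cos (\<theta> j) \<le> cos (\<theta> i)" if "i \<le> j" "2 * j \<le> n + 1" for i j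
  proof (rule cos_monotone_0_pi_le)
    show "0 \<le> \<theta> i" by (simp add: \<theta>_def)
    show "\<theta> i \<le> \<theta> j" using that by (simp add: \<theta>_def divide_right_mono)
    have "2 * real j \<le> real n + 1" using that(2) by linarith
    then have "pi * (2 * real j) \<le> pi * (real n + 1)" by (intro mult_left_mono) auto
    then show "\<theta> j \<le> pi" by (simp add: \<theta>_def field_simps)
  qed
  have strict: "cos (\<theta> j) < cos (\<theta> i)" if "i < j" "2 * j \<le> n + 1" for i j
  proof (rule cos_monotone_0_pi)
    show "0 \<le> \<theta> i" by (simp add: \<theta>_def)
    show "\<theta> i < \<theta> j" using that by (simp add: \<theta>_def divide_strict_right_mono)
    have "2 * real j \<le> real n + 1" using that(2) by linarith
    then have "pi * (2 * real j) \<le> pi * (real n + 1)" by (intro mult_left_mono) auto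
    then show "\<theta> j \<le> pi" by (simp add: \<theta>_def field_simps)
  qed
  have u: "u1 n = cos (\<theta> k)" "u2 n = cos (\<theta> (k + 1))"
    by (simp_all add: u1_def u2_def \<theta>_def k(1) add.commute)
  show "u1 n < 1" using strict[of 0 k] k u by (simp add: \<theta>_def)
  show "u2 n < u1 n" using strict[of k "k + 1"] k u by simp
  fix \<omega> :: complex assume "\<omega> ^ (n + 1) = 1" "\<omega> \<noteq> 1"
  then obtain j where j: "1 \<le> j" "2 * j \<le> n + 1" "Re \<omega> = cos (\<theta> j)"
    unfolding \<theta>_def by (rule Re_unity_root)
  show "(Re \<omega> - u1 n) * (Re \<omega> - u2 n) \<ge> 0"
  proof (cases "j \<le> k")
    case True
    then have "Re \<omega> \<ge> u1 n" using mono[of j k] k j u by simp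
    then show ?thesis using \<open>u2 n < u1 n\<close> by (intro mult_nonneg_nonneg) auto
  next
    case False
    then have "Re \<omega> \<le> u2 n" using mono[of "k + 1" j] k j u by simp
    then show ?thesis using \<open>u2 n < u1 n\<close> by (intro mult_nonpos_nonpos) auto
  qed
qed

definition slope :: "nat \<Rightarrow> real" where
  "slope n = D1 n + D2 n / real n"

text \<open>
  The coefficients \<open>m\<close> and \<open>m'\<close> of \<open>\<mu> = m e + m' e^2\<close>.  The first one makes \<open>G\<close> vanish at \<open>u1\<close> and
  \<open>u2\<close>.  The second one comes from solving \<open>H(u1) = H(u2) = 0\<close> for \<open>m'\<close>.
\<close>

definition angle1 :: "nat \<Rightarrow> real" where
  "angle1 n = - D2 n"

definition angle2 :: "nat \<Rightarrow> real" where
  "angle2 n = (let m = angle1 n; y = 1 / real n; u = u1 n; v = u2 n in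
     - (m\<^sup>2 * (16 - 8 * real n) * ((u + v)\<^sup>2 - u * v) + 8 * y * m\<^sup>2 * (u + v)
       + m\<^sup>2 * (6 * real n - 12 + 6 * y) + 8 * slope n * m + 2 * m) / 4)"

lemma first_order_gap:
  assumes "n \<ge> 3"
  shows "angle1 n > 0"
    and "2 * angle1 n * (1 - u1 n) * (1 - u2 n) = 1"
    and "angle1 n * ((1 - u) * (2 * u + 1 + 1 / real n)) + (1 - u) * (1 + slope n) - 1
      = - 2 * angle1 n * ((u - u1 n) * (u - u2 n))"
proof -
  have pos: "1 - u1 n > 0" "1 - u2 n > 0" using u1_u2[OF assms] by auto
  show "angle1 n > 0" using pos by (simp add: angle1_def D2_def)
  show m: "2 * angle1 n * (1 - u1 n) * (1 - u2 n) = 1"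
    using pos by (simp add: angle1_def D2_def)
  have "slope n = - (2 * u1 n * u2 n + 1) * angle1 n - angle1 n * (1 / real n)"
    by (simp add: slope_def D1_def D2_def angle1_def field_simps)
  then show "angle1 n * ((1 - u) * (2 * u + 1 + 1 / real n)) + (1 - u) * (1 + slope n) - 1
      = - 2 * angle1 n * ((u - u1 n) * (u - u2 n))"
    using m by algebra
qed

text \<open>
  The left-hand side is the coefficient \<open>H\<close> of \<open>excess_expansion\<close> with the data of the branch
  inserted: the second order of the excess vanishes at the tight roots.
\<close>

lemma second_order_balance:
  assumes "n \<ge> 3" "u = u1 n \<or> u = u2 n"
  defines "y \<equiv> 1 / real n"
  shows "2 * ((1 - u) * (2 * u + 1 + y)) * angle2 n + (1 - u) * quad_coeff n u * (angle1 n)\<^sup>2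
     + 4 * ((1 - u) * (2 * u + 1 + y)) * slope n * angle1 n + 2 * (1 - u) * (DD n + slope n * (1 + slope n))
     - 2 * ((1 - y) * (1 - u)) * angle1 n * (1 + slope n) + 1 = 0"
proof -
  define v where "v = (if u = u1 n then u2 n else u1 n)"
  have m: "2 * angle1 n * (1 - u1 n) * (1 - u2 n) = 1" by (rule first_order_gap(2)[OF assms(1)])
  have uv: "2 * angle1 n * (1 - u) * (1 - v) = 1" "u * v = u1 n * u2 n" "u + v = u1 n + u2 n"
  proof -
    consider "u = u1 n" "v = u2 n" | "u = u2 n" "v = u1 n"
      using assms(2) by (auto simp: v_def)
    then have "2 * angle1 n * (1 - u) * (1 - v) = 1 \<and> u * v = u1 n * u2 n \<and> u + v = u1 n + u2 n"
    proof cases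
      case 2
      show ?thesis using m unfolding 2 by (simp only: mult_ac add_ac)
    qed (use m in simp)
    then show "2 * angle1 n * (1 - u) * (1 - v) = 1" "u * v = u1 n * u2 n" "u + v = u1 n + u2 n" by blast+
  qed
  have "D1 n = - (2 * (u1 n * u2 n) + 1) * angle1 n"
    by (simp add: D1_def D2_def angle1_def field_simps)
  then have d1: "D1 n = - (2 * u * v + 1) * angle1 n" by (simp add: mult.assoc uv(2))
  have W: "2 * angle2 n * (2 * u + 1 + y)
     + (angle1 n)\<^sup>2 * quad_coeff n u
     + 4 * slope n * angle1 n * (2 * u + 1 + y) + 2 * DD n + 2 * slope n * (1 + slope n)
     - 2 * (1 + slope n) * angle1 n * (1 - y) + angle1 n * (2 * u + 1 + y) + 1 + slope n = 0"
    unfolding quad_coeff_def y_def[symmetric]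
  proof (rule balance_identity[OF uv(1) _ d1, where ?d2.0 = "D2 n"])
    show "real n * y = 1" using assms(1) by (simp add: y_def)
    show "D2 n = - angle1 n" by (simp add: angle1_def)
    show "slope n = D1 n + D2 n * y" by (simp add: slope_def y_def)
  qed (simp_all add: DD_def D3_def D4_def D5_def D6_def angle2_def Let_def uv power_divide y_def)
  have "angle1 n * ((1 - u) * (2 * u + 1 + y)) + (1 - u) * (1 + slope n) = 1"
    using first_order_gap(3)[OF assms(1), of u] assms(2) unfolding y_def by (elim disjE) simp_all
  then show ?thesis using W by algebra
qed

section \<open>A family of polynomials with the required critical distance\<close>

text \<open>
  The estimates must hold for all roots on a branch at once.  This is expressed by the filter of
  pairs \<open>(e, q)\<close> with \<open>e\<close> tending to \<open>0\<close> from the right and \<open>q\<close> on the branch.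
\<close>

lemma root_branch_in_disk:
  fixes n :: nat and \<omega> :: complex
  assumes n: "n \<ge> 3" and \<omega>: "\<omega> ^ (n + 1) = 1"
  defines "\<mu> \<equiv> \<lambda>e. angle1 n * e + angle2 n * e\<^sup>2"
  shows "\<exists>K0. \<forall>K\<ge>K0. \<forall>\<^sub>F e in at_right (0::real). \<forall>q. branch n (\<mu> e) \<omega> q \<longrightarrow> norm (of_real (1 - e) + of_real (radius (slope n) (DD n) K e) * (q - 1)) \<le> 1"
proof -
  define S where "S = {x. branch n (\<mu> (fst x)) \<omega> (snd x)}"
  define F where "F = inf (filtercomap fst (at_right (0::real))) (principal S)"
  have lim: "filterlim fst (at_right 0) F"
    unfolding F_def by (rule filterlim_mono[OF filterlim_filtercomap]) auto
  have e: "(fst \<longlongrightarrow> (0::real)) F"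
    using lim unfolding filterlim_at by simp
  have pos: "\<forall>\<^sub>F x in F. fst x > (0::real)"
    using lim unfolding filterlim_at by (auto elim: eventually_mono)
  have lt1: "\<forall>\<^sub>F x in F. fst x < (1::real)"
    using e by (rule order_tendstoD(2)) simp
  have inS: "\<forall>\<^sub>F x in F. x \<in> S"
    unfolding F_def by (simp add: eventually_inf_principal)
  have tr: "\<forall>\<^sub>F e in at_right (0::real). \<forall>q. (e, q) \<in> S \<longrightarrow> P (e, q)" if "\<forall>\<^sub>F x in F. P x" for P
  proof -
    from that obtain Q where Q: "eventually Q (at_right 0)" "\<And>x. Q (fst x) \<Longrightarrow> x \<in> S \<Longrightarrow> P x"
      unfolding F_def eventually_inf_principal eventually_filtercomap by auto
    from Q(1) show ?thesis by (rule eventually_mono) (use Q(2) in auto)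
  qed
  have "\<exists>K0. \<forall>K\<ge>K0. \<forall>\<^sub>F x in F. norm (of_real (1 - fst x) + of_real (radius (slope n) (DD n) K (fst x)) * (snd x - 1)) \<le> 1"
  proof -
    have "((\<lambda>x. angle1 n + angle2 n * fst x) \<longlongrightarrow> angle1 n + angle2 n * 0) F"
      by (intro tendsto_intros e)
    then have "(\<lambda>x. angle1 n + angle2 n * fst x) \<in> O[F](\<lambda>_. 1)"
      by (intro bigoI_tendsto) auto
    from landau_o.big.mult[OF this landau_o.big_refl[of fst]]
    have \<mu>O: "(\<lambda>x. \<mu> (fst x)) \<in> O[F](fst)"
      by (simp add: \<mu>_def algebra_simps power2_eq_square)
    have \<mu>0: "((\<lambda>x. \<mu> (fst x)) \<longlongrightarrow> 0) F" by (rule bigo_tendsto_0[OF \<mu>O e])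
    have q: "\<forall>\<^sub>F x in F. snd x = \<omega> * exp (Ln (1 + of_real (\<mu> (fst x)) * drift n (snd x)) / of_nat (n + 1))"
      and q2: "\<forall>\<^sub>F x in F. norm (snd x) \<le> 2"
      and qr: "\<forall>\<^sub>F x in F. snd x ^ (n + 1) = 1 + of_real (\<mu> (fst x)) * drift n (snd x)"
      using inS by (auto elim!: eventually_mono simp: S_def branch_def)
    have n1: "n \<ge> 1" using n by simp
    show ?thesis
    proof (cases "\<omega> = 1")
      case True
      define \<tau> where "\<tau> = (\<lambda>x. Ln (1 + of_real (\<mu> (fst x)) * drift n (snd x)) / of_nat (n + 1))"
      have q': "\<forall>\<^sub>F x in F. snd x = \<omega> * exp (\<tau> x)" using q by (simp add: \<tau>_def)
      have "\<tau> \<in> O[F](\<lambda>x. complex_of_real (fst x))"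
        by (rule root_log_expansion(1)[OF n1 \<omega> e \<mu>O fun_cong[OF \<tau>_def] q' q2])
      then have "(\<tau> \<longlongrightarrow> 0) F"
        by (rule bigo_tendsto_0) (use tendsto_of_real[OF e, where 'a = complex] in simp)
      then have "((\<lambda>x. \<omega> * exp (\<tau> x)) \<longlongrightarrow> \<omega> * exp 0) F" by (intro tendsto_intros)
      then have "(snd \<longlongrightarrow> 1) F"
        using q' True by (subst tendsto_cong[OF q']) simp
      from branch_at_1_trivial[OF this \<mu>0 qr] have "\<forall>\<^sub>F x in F. snd x = 1" .
      then have "\<forall>\<^sub>F x in F. norm (of_real (1 - fst x) + of_real (radius (slope n) (DD n) K (fst x)) * (snd x - 1)) \<le> 1" for K
        using pos lt1 by eventually_elim (simp del: of_real_diff)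
      then show ?thesis by blast
    next
      case False
      define u where "u = Re \<omega>"
      have \<omega>1: "norm \<omega> = 1" using \<omega> by (rule norm_unity_root)
      have "u \<noteq> 1"
        using \<omega>1 False by (auto simp: u_def cmod_def complex_eq_iff)
      moreover have "u \<le> 1" using \<omega>1 complex_Re_le_cmod[of \<omega>] by (simp add: u_def)
      ultimately have d: "1 - u > 0" by simp
      note re = Re_log_coeffs[OF \<omega>1, of n, folded u_def]
      note expn = root_modulus_expansion[OF n1 \<omega> e \<mu>O q q2]
      have p: "(\<lambda>x. (norm (snd x))\<^sup>2 - 1 - (2 * ((1 - u) * (2 * u + 1 + 1 / real n)) * \<mu> (fst x)
           + (1 - u) * quad_coeff n u * (\<mu> (fst x))\<^sup>2)) \<in> O[F](\<lambda>x. fst x ^ 3)"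
        using expn(1) unfolding re(2) unfolding re(1) .
      have r: "(\<lambda>x. Re (snd x) - (1 - (1 - u) + ((1 - 1 / real n) * (1 - u)) * \<mu> (fst x))) \<in> O[F](\<lambda>x. fst x ^ 2)"
        using expn(2) unfolding re u_def[symmetric] by simp
      have p0: "((\<lambda>x. (norm (snd x))\<^sup>2 - 1) \<longlongrightarrow> 0) F"
      proof -
        have "((\<lambda>x. (norm (snd x))\<^sup>2 - 1 - (2 * ((1 - u) * (2 * u + 1 + 1 / real n)) * \<mu> (fst x)
           + (1 - u) * quad_coeff n u * (\<mu> (fst x))\<^sup>2)) \<longlongrightarrow> 0) F"
          by (rule bigo_tendsto_0[OF p]) (use tendsto_power[OF e, of 3] in simp)
        moreover have "((\<lambda>x. 2 * ((1 - u) * (2 * u + 1 + 1 / real n)) * \<mu> (fst x)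
           + (1 - u) * quad_coeff n u * (\<mu> (fst x))\<^sup>2) \<longlongrightarrow>
             2 * ((1 - u) * (2 * u + 1 + 1 / real n)) * 0 + (1 - u) * quad_coeff n u * 0\<^sup>2) F"
          by (intro tendsto_intros \<mu>0)
        ultimately show ?thesis by (force dest: tendsto_add)
      qed
      have r0: "((\<lambda>x. Re (snd x)) \<longlongrightarrow> 1 - (1 - u)) F"
      proof -
        have "((\<lambda>x. Re (snd x) - (1 - (1 - u) + ((1 - 1 / real n) * (1 - u)) * \<mu> (fst x))) \<longlongrightarrow> 0) F"
          by (rule bigo_tendsto_0[OF r]) (use tendsto_power[OF e, of 2] in simp)
        moreover have "((\<lambda>x. 1 - (1 - u) + ((1 - 1 / real n) * (1 - u)) * \<mu> (fst x)) \<longlongrightarrow>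
             1 - (1 - u) + ((1 - 1 / real n) * (1 - u)) * 0) F"
          by (intro tendsto_intros \<mu>0)
        ultimately show ?thesis by (force dest: tendsto_add)
      qed
      define G where "G = 2 * ((1 - u) * (2 * u + 1 + 1 / real n)) * angle1 n + 2 * (1 - u) * (1 + slope n) - 2"
      \<comment> \<open>Tightness at \<open>u1\<close> and \<open>u2\<close>, and negativity at all other roots of unity.\<close>
      have G: "G = - 4 * angle1 n * ((u - u1 n) * (u - u2 n))"
        using first_order_gap(3)[OF n, of u] unfolding G_def by algebra
      have "(u - u1 n) * (u - u2 n) \<ge> 0" using u1_u2(3)[OF n \<omega> False] by (simp add: u_def)
      then have "G < 0 \<or> G = 0 \<and> (u = u1 n \<or> u = u2 n)"
        using first_order_gap(1)[OF n] unfolding G by (auto simp: less_le mult_less_0_iff)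
      then have "\<exists>K0. \<forall>K\<ge>K0. \<forall>\<^sub>F x in F. excess (radius (slope n) (DD n) K (fst x)) (1 - fst x) (snd x) \<le> 0"
        using second_order_balance[OF n, of u]
        by (intro excess_eventually_nonpos[OF e pos d p0 r0
            excess_expansion[OF e p[unfolded \<mu>_def] r[unfolded \<mu>_def], where c = "slope n" and D = "DD n"]])
          (auto simp: G_def)
      then show ?thesis unfolding excess_eq by (simp add: power2_le_iff_abs_le abs_square_le_1)
    qed
  qed
  then obtain K0 where K0: "\<forall>K\<ge>K0. \<forall>\<^sub>F x in F. norm (of_real (1 - fst x) + of_real (radius (slope n) (DD n) K (fst x)) * (snd x - 1)) \<le> 1"
    by blast
  show ?thesis
  proof (rule exI[of _ K0], intro allI impI)
    fix K assume "K \<ge> K0"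
    with K0 have "\<forall>\<^sub>F x in F. norm (of_real (1 - fst x) + of_real (radius (slope n) (DD n) K (fst x)) * (snd x - 1)) \<le> 1"
      by blast
    from tr[OF this] show "\<forall>\<^sub>F e in at_right (0::real). \<forall>q. branch n (\<mu> e) \<omega> q \<longrightarrow> norm (of_real (1 - e) + of_real (radius (slope n) (DD n) K e) * (q - 1)) \<le> 1"
      unfolding S_def by simp
  qed
qed

theorem proposition7:
  fixes n :: nat
  assumes "n \<ge> 3"
  shows "\<exists>(P :: real \<Rightarrow> complex poly) (C :: real) (\<beta>\<^sub>0 :: real). 0 \<le> \<beta>\<^sub>0 \<and> \<beta>\<^sub>0 < 1 \<and>
    (\<forall>\<beta>. \<beta>\<^sub>0 < \<beta> \<and> \<beta> < 1 \<longrightarrow>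
       P \<beta> \<in> sendov_class (n + 1) \<beta> \<and>
       (\<forall>i. coeff (P \<beta>) i \<in> \<real>) \<and>
       \<bar>crit_dist \<beta> (P \<beta>) -
          (1 + (D1 n + D2 n / real n) * (1 - \<beta>) + DD n * (1 - \<beta>)\<^sup>2)\<bar>
         \<le> C * (1 - \<beta>) powr (alpha n + 1))"
proof -
  define \<mu> where "\<mu> = (\<lambda>e. angle1 n * e + angle2 n * e\<^sup>2)"
  define U where "U = {\<omega> :: complex. \<omega> ^ (n + 1) = 1}"
  have "finite U" unfolding U_def using finite_roots_unity[of "n + 1"] assms by simp
  have "\<forall>\<omega>\<in>U. \<exists>K0. \<forall>K\<ge>K0. \<forall>\<^sub>F e in at_right (0::real). \<forall>q. branch n (\<mu> e) \<omega> q \<longrightarrow> norm (of_real (1 - e) + of_real (radius (slope n) (DD n) K e) * (q - 1)) \<le> 1"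
    using root_branch_in_disk[OF assms] by (simp add: U_def \<mu>_def)
  from bchoice[OF this] obtain K0 where K0: "\<forall>\<omega>\<in>U. \<forall>K\<ge>K0 \<omega>. \<forall>\<^sub>F e in at_right (0::real). \<forall>q. branch n (\<mu> e) \<omega> q \<longrightarrow>
      norm (of_real (1 - e) + of_real (radius (slope n) (DD n) K e) * (q - 1)) \<le> 1" ..
  define K where "K = Max (K0 ` U)"
  have K: "K \<ge> K0 \<omega>" if "\<omega> \<in> U" for \<omega> using that \<open>finite U\<close> by (simp add: K_def)
  define R where "R = radius (slope n) (DD n) K"
  have ev: "\<forall>\<^sub>F e in at_right (0::real). \<forall>\<omega>\<in>U. \<forall>q. branch n (\<mu> e) \<omega> q \<longrightarrow> norm (of_real (1 - e) + of_real (R e) * (q - 1)) \<le> 1"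
    unfolding R_def using K0 K by (intro eventually_ball_finite[OF \<open>finite U\<close>]) blast
  have e0: "((\<lambda>e. e) \<longlongrightarrow> (0::real)) (at_right 0)" by (rule tendsto_ident_at)
  have "((\<lambda>e. \<mu> e) \<longlongrightarrow> angle1 n * 0 + angle2 n * 0\<^sup>2) (at_right 0)"
    unfolding \<mu>_def by (intro tendsto_intros e0)
  then have \<mu>0: "(\<mu> \<longlongrightarrow> 0) (at_right 0)" by simp
  have "((\<lambda>e. R e) \<longlongrightarrow> 1 + slope n * 0 + DD n * 0\<^sup>2 - K * 0 ^ 3) (at_right 0)"
    unfolding R_def radius_def by (intro tendsto_intros e0)
  then have "\<forall>\<^sub>F e in at_right 0. R e > 0" by (intro order_tendstoD(1)[where y = 1]) auto
  moreover have "\<forall>\<^sub>F e in at_right 0. \<mu> e > 0"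
  proof -
    have "((\<lambda>e. angle1 n + angle2 n * e) \<longlongrightarrow> angle1 n + angle2 n * 0) (at_right 0)"
      by (intro tendsto_intros e0)
    then have "\<forall>\<^sub>F e in at_right 0. angle1 n + angle2 n * e > 0"
      using first_order_gap(1)[OF assms] by (intro order_tendstoD(1)) auto
    then show ?thesis using eventually_at_right_less[of 0]
    proof eventually_elim
      case (elim e)
      then have "e * (angle1 n + angle2 n * e) > 0" by simp
      then show ?case by (simp add: \<mu>_def algebra_simps power2_eq_square)
    qed
  qed
  moreover have "\<forall>\<^sub>F e in at_right 0. \<mu> e * (real n - 1) < 4"
    by (rule order_tendstoD(2)[OF tendsto_mult_left_zero[OF \<mu>0]]) simp
  moreover have "\<forall>\<^sub>F e in at_right 0. \<bar>\<mu> e\<bar> * (4 * real (n + 1) * 2 ^ n) < 1"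
    by (rule order_tendstoD(2)[OF tendsto_mult_left_zero[OF tendsto_rabs_zero[OF \<mu>0]]]) simp
  ultimately have "\<forall>\<^sub>F e in at_right (0::real). R e > 0 \<and> \<mu> e > 0 \<and> \<mu> e * (real n - 1) < 4 \<and>
      \<bar>\<mu> e\<bar> * (4 * real (n + 1) * 2 ^ n) < 1 \<and> (\<forall>\<omega>\<in>U. \<forall>q. branch n (\<mu> e) \<omega> q \<longrightarrow> norm (of_real (1 - e) + of_real (R e) * (q - 1)) \<le> 1)"
    using ev by eventually_elim blast
  then obtain b where b: "b > 0" and good: "\<And>e. 0 < e \<Longrightarrow> e < b \<Longrightarrow> R e > 0 \<and> \<mu> e > 0 \<and> \<mu> e * (real n - 1) < 4 \<and>
      \<bar>\<mu> e\<bar> * (4 * real (n + 1) * 2 ^ n) < 1 \<and> (\<forall>\<omega>\<in>U. \<forall>q. branch n (\<mu> e) \<omega> q \<longrightarrow> norm (of_real (1 - e) + of_real (R e) * (q - 1)) \<le> 1)"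
    unfolding eventually_at_right_field by auto
  define P where "P = (\<lambda>\<beta>. circle_poly n \<beta> (R (1 - \<beta>)) (\<mu> (1 - \<beta>)))"
  show ?thesis
  proof (rule exI[of _ P], rule exI[of _ "\<bar>K\<bar>"], rule exI[of _ "max 0 (1 - b)"], intro conjI allI impI)
    show "0 \<le> max 0 (1 - b)" "max 0 (1 - b) < 1" using b by auto
    fix \<beta> :: real assume \<beta>: "max 0 (1 - b) < \<beta> \<and> \<beta> < 1"
    define e where "e = 1 - \<beta>"
    have e: "0 < e" "e < b" "e < 1" "\<beta> = 1 - e" using \<beta> by (auto simp: e_def)
    note g = good[OF e(1,2)]
    have P: "P \<beta> = circle_poly n \<beta> (R e) (\<mu> e)" by (simp add: P_def e_def)
    show "coeff (P \<beta>) i \<in> \<real>" for i unfolding P by (rule real_coeffs_circle_poly)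
    have root: "norm z \<le> 1" if "poly (P \<beta>) z = 0" for z
    proof -
      define q where "q = 1 + (z - of_real \<beta>) / of_real (R e)"
      have z: "z = of_real (1 - e) + of_real (R e) * (q - 1)" using g e(4) by (simp add: q_def)
      have q: "q ^ (n + 1) = 1 + of_real (\<mu> e) * drift n q"
        using that unfolding P poly_circle_poly q_def by simp
      have "n \<ge> 1" using assms by simp
      then obtain \<omega> where "\<omega> \<in> U" "branch n (\<mu> e) \<omega> q"
        using root_on_branch[of n "\<mu> e" q] g q unfolding U_def by blast
      then show ?thesis using g unfolding z by blast
    qed
    have "poly (P \<beta>) (of_real \<beta>) = 0" unfolding P poly_circle_poly by (simp add: drift_def)
    moreover have "degree (P \<beta>) = n + 1" unfolding P using g assms by (intro degree_circle_poly) auto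
    ultimately show "P \<beta> \<in> sendov_class (n + 1) \<beta>" using root by (simp add: sendov_class_def)
    have "crit_dist \<beta> (P \<beta>) = R e"
      unfolding P using g assms by (intro crit_dist_circle_poly) auto
    then have "\<bar>crit_dist \<beta> (P \<beta>) - (1 + (D1 n + D2 n / real n) * (1 - \<beta>) + DD n * (1 - \<beta>)\<^sup>2)\<bar> = \<bar>K\<bar> * e powr 3"
      using e(1) by (simp add: R_def radius_def slope_def e_def abs_mult)
    also have "e powr 3 \<le> e powr (alpha n + 1)"
      using e by (intro powr_mono') (auto simp: alpha_def)
    finally show "\<bar>crit_dist \<beta> (P \<beta>) - (1 + (D1 n + D2 n / real n) * (1 - \<beta>) + DD n * (1 - \<beta>)\<^sup>2)\<bar>
         \<le> \<bar>K\<bar> * (1 - \<beta>) powr (alpha n + 1)"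
      by (simp add: e_def mult_left_mono)
  qed
qed

end
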